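(* Let $A\in\mathbb{R}^{m\times n}$. Given an input of the modified Incremental Representation Reduction procedure (mIRR), that is, an ordered set of indices $B\subseteq\{1,\dots,n\}$ such that $A_B$ has affinely independent columns, the pseudoinverse $\tilde{A}_B^\dagger$, an index $j\notin B$, and a point $y=Ax=A_Bx_B+A_jx_j$ with $x\in\Delta_{n-1}$ and $x_i=0$ for all $i\notin B\cup\{j\}$, the mIRR produces, in $O(m^2)$ operations (with an absolute implied constant), an affinely independent representation of $y$, namely an ordered set of indices $B^+$ such that $A_{B^+}$ has affinely independent columns and a vector $x^+\in\Delta_{n-1}$ with $x^+_i=0$ for all $i\notin B^+$ and $y=Ax^+=A_{B^+}x^+_{B^+}$, together with the pseudoinverse $\tilde{A}_{B^+}^\dagger$.
   Context: $\Delta_{n-1}:=\{x\in\mathbb{R}^n:\|x\|_1=1,\ x\ge 0\}$. For an ordered set of (distinct) indices $B=[B(1),\dots,B(k)]\subseteq\{1,\dots,n\}$, $A\in\mathbb{R}^{m\times n}$ and $x\in\mathbb{R}^n$: $A_i$ is the $i$-th column of $A$, $A_B=[A_{B(1)}\ \cdots\ A_{B(k)}]$, $x_B=(x_{B(1)},\dots,x_{B(k)})$. $\tilde{A}\in\mathbb{R}^{(m+1)\times n}$ is $A$ with a row of ones added on top; $\tilde A_B,\tilde A_j$ are defined accordingly. For a full column rank matrix $M$, $M^\dagger=(M^TM)^{-1}M^T$. "Operations" are arithmetic operations and comparisons on real numbers. Here $m\ge1$. The procedure mIRR, with input $B=[B(1),\dots,B(k)]$, $\tilde A_B^\dagger$,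 $j\notin B$ and $x$ as in the claim, and with $B':=[B(1),\dots,B(k),j]$, is: (1) Compute $u'=\tilde{A}_B^\dagger\tilde{A}_j\in\mathbb{R}^k$ and $u=(u',-1)\in\mathbb{R}^{k+1}$. If $\tilde{A}_Bu'\ne\tilde{A}_j$, output $x^+=x$, $B^+=B'$ and $$\tilde{A}_{B^+}^\dagger=\begin{bmatrix}\tilde{A}_B^\dagger\\0\end{bmatrix}-\begin{bmatrix}\tilde{A}_B^\dagger\tilde{A}_j\\-1\end{bmatrix}\frac{\tilde{A}_j^T(I-\tilde{A}_B\tilde{A}_B^\dagger)}{\tilde{A}_j^T(I-\tilde{A}_B\tilde{A}_B^\dagger)\tilde{A}_j},$$ and stop. Otherwise continue. (2) Let $\theta^*=\max_{i:u_i<0}\frac{x_{B'(i)}}{u_i}$, let $i^*$ be the smallest index $i$ with $u_i<0$ attaining this maximum, and set $x^+_{B'}=x_{B'}-\theta^*u$ and $x^+_i=0$ for $i\notin B'$. If $i^*=k+1$ (that is, $B'(i^* )=j$), output $x^+$, $B^+=B$, $\tilde{A}_{B^+}^\dagger=\tilde{A}_B^\dagger$ and stop. Otherwise continue. (3) Let $B^+$ be $B$ with its $i^*$-th entry replaced by $j$. Form the $k\times(m+2)$ matrix $[\tilde{A}_B^\dagger\mid u']$ and add to each row (including the $i^*$-th row itself) a multiple of the $i^*$-th row so that the last column becomes the unit vector $e_{i^*}$. Output $x^+$, $B^+$, and as $\tilde{A}_{B^+}^\dagger$ the first $m+1$ columns of the resulting matrix. *)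

theory Defs
  imports
    "Jordan_Normal_Form.Gauss_Jordan_Elimination"
    "HOL-Library.Monad_Syntax"
begin

text \<open>All indices (of rows, of columns, and of positions in an ordered index set) start at 0.
  An ordered set of indices is a distinct list, and may be empty.\<close>

section \<open>Vectors and matrices\<close>

definition std_simplex :: "nat \<Rightarrow> real vec set" where
  "std_simplex n = {x \<in> carrier_vec n. (\<Sum>i<n. \<bar>x $ i\<bar>) = 1 \<and> (\<forall>i<n. 0 \<le> x $ i)}"

definition sub_cols :: "'a mat \<Rightarrow> nat list \<Rightarrow> 'a mat" where
  "sub_cols A B = mat_of_cols (dim_row A) (map (col A) B)"

definition sub_vec :: "'a vec \<Rightarrow> nat list \<Rightarrow> 'a vec" where
  "sub_vec x B = vec (length B) (\<lambda>i. x $ (B ! i))"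

definition aff_indep_cols :: "real mat \<Rightarrow> bool" where
  "aff_indep_cols M \<longleftrightarrow>
     (\<forall>c \<in> carrier_vec (dim_col M).
        M *\<^sub>v c = 0\<^sub>v (dim_row M) \<and> (\<Sum>i<dim_col M. c $ i) = 0 \<longrightarrow> c = 0\<^sub>v (dim_col M))"

text \<open>Meaningful for full column rank only: otherwise \<open>mat_inverse\<close> returns \<open>None\<close>.\<close>

definition pinv :: "real mat \<Rightarrow> real mat" where
  "pinv M = the (mat_inverse (M\<^sup>T * M)) * M\<^sup>T"

definition top_row :: "'a \<Rightarrow> 'a mat \<Rightarrow> 'a mat" where
  "top_row e A = mat (dim_row A + 1) (dim_col A) (\<lambda>(i, j). if i = 0 then e else A $$ (i - 1, j))"

abbreviation tilde :: "real mat \<Rightarrow> real mat" where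
  "tilde A \<equiv> top_row 1 A"


section \<open>The procedure as a mathematical function\<close>

text \<open>Positions in the list \<open>B' = B @ [j]\<close> run from 0 to \<open>k\<close>, where \<open>k\<close> is the length
  of \<open>B\<close> and the position of \<open>j\<close>.\<close>

definition mIRR_independent :: "real mat \<Rightarrow> nat list \<Rightarrow> real mat \<Rightarrow> nat \<Rightarrow> real mat" where
  "mIRR_independent A B P j =
    (let m = dim_row A; k = length B;
         AB = sub_cols (tilde A) B; a = col (tilde A) j;
         q = mat_of_row a * (1\<^sub>m (m + 1) - AB * P);
         u = (P *\<^sub>v a) @\<^sub>v vec 1 (\<lambda>_. - 1)
     in (P @\<^sub>r 0\<^sub>m 1 (m + 1)) - (1 / ((q *\<^sub>v a) $ 0)) \<cdot>\<^sub>m (mat_of_cols (k + 1) [u] * q))"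

definition mIRR_theta :: "nat list \<Rightarrow> real vec \<Rightarrow> real vec \<Rightarrow> real" where
  "mIRR_theta B' u x = Max {x $ (B' ! i) / u $ i | i. i < length B' \<and> u $ i < 0}"

definition mIRR_leaving :: "nat list \<Rightarrow> real vec \<Rightarrow> real vec \<Rightarrow> nat" where
  "mIRR_leaving B' u x =
     (LEAST i. i < length B' \<and> u $ i < 0 \<and> x $ (B' ! i) / u $ i = mIRR_theta B' u x)"

text \<open>The vector in \<open>\<real>\<^sup>n\<close> with the entries \<open>z\<close> at the indices listed in \<open>B'\<close> and \<open>e\<close> elsewhere.\<close>

definition scatter :: "'a \<Rightarrow> nat \<Rightarrow> nat list \<Rightarrow> 'a vec \<Rightarrow> 'a vec" where
  "scatter e n B' z =
     vec n (\<lambda>l. case map_of (zip B' [0..<length B']) l of None \<Rightarrow> e | Some i \<Rightarrow> z $ i)"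

text \<open>The multiplier \<open>\<mu> r\<close> below is the only one for which adding \<open>\<mu> r\<close> times row \<open>s\<close> to row \<open>r\<close>
  turns the last entry \<open>u' $ r\<close> of row \<open>r\<close> into entry \<open>r\<close> of the unit vector \<open>e\<^sub>s\<close>.\<close>

definition mIRR_pivot :: "real mat \<Rightarrow> real vec \<Rightarrow> nat \<Rightarrow> real mat" where
  "mIRR_pivot P u' s =
    (let k = dim_row P; d = dim_col P;
         M = mat k (d + 1) (\<lambda>(r, c). if c < d then P $$ (r, c) else u' $ r);
         \<mu> = (\<lambda>r. ((if r = s then 1 else 0) - u' $ r) / u' $ s);
         M' = mat k (d + 1) (\<lambda>(r, c). M $$ (r, c) + \<mu> r * M $$ (s, c))
     in mat k d (\<lambda>(r, c). M' $$ (r, c)))"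

definition mIRR ::
  "real mat \<Rightarrow> nat list \<Rightarrow> real mat \<Rightarrow> nat \<Rightarrow> real vec \<Rightarrow> real vec \<times> nat list \<times> real mat" where
  "mIRR A B P j x =
    (let n = dim_col A; k = length B; B' = B @ [j];
         AB = sub_cols (tilde A) B; a = col (tilde A) j;
         u' = P *\<^sub>v a; u = u' @\<^sub>v vec 1 (\<lambda>_. - 1)
     in if AB *\<^sub>v u' \<noteq> a then (x, B', mIRR_independent A B P j)
        else
          let \<theta> = mIRR_theta B' u x; s = mIRR_leaving B' u x;
              xp = scatter 0 n B' (sub_vec x B' - \<theta> \<cdot>\<^sub>v u)
          in if s = k then (xp, B, P)
             else (xp, B[s := j], mIRR_pivot P u' s))"


section \<open>Programs over real numbers and their operation counts\<close>

text \<open>A program is a decision tree over an abstract type \<open>'v\<close> of numbers. Numbers can be combined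
  only by \<open>Arith\<close> and inspected only by \<open>Compare\<close>, so that a program that is polymorphic
  in \<open>'v\<close> has no access to uncounted real arithmetic. Index manipulation, copying of numbers
  and integer constants are free. Division by zero is an error (\<open>None\<close>).\<close>

datatype arith = Add | Sub | Mul | Div

datatype cmp = Less | Equal

datatype ('v, 'a) prog =
    Return 'a
  | Const int "'v \<Rightarrow> ('v, 'a) prog"
  | Arith arith 'v 'v "'v \<Rightarrow> ('v, 'a) prog"
  | Compare cmp 'v 'v "bool \<Rightarrow> ('v, 'a) prog"

primrec prog_bind :: "('v, 'a) prog \<Rightarrow> ('a \<Rightarrow> ('v, 'b) prog) \<Rightarrow> ('v, 'b) prog" where
  "prog_bind (Return a) f = f a"
| "prog_bind (Const c g) f = Const c (\<lambda>v. prog_bind (g v) f)"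
| "prog_bind (Arith p v w g) f = Arith p v w (\<lambda>z. prog_bind (g z) f)"
| "prog_bind (Compare p v w g) f = Compare p v w (\<lambda>b. prog_bind (g b) f)"

adhoc_overloading Monad_Syntax.bind \<rightleftharpoons> prog_bind

fun arith_sem :: "arith \<Rightarrow> real \<Rightarrow> real \<Rightarrow> real option" where
  "arith_sem Add v w = Some (v + w)"
| "arith_sem Sub v w = Some (v - w)"
| "arith_sem Mul v w = Some (v * w)"
| "arith_sem Div v w = (if w = 0 then None else Some (v / w))"

fun cmp_sem :: "cmp \<Rightarrow> real \<Rightarrow> real \<Rightarrow> bool" where
  "cmp_sem Less v w = (v < w)"
| "cmp_sem Equal v w = (v = w)"

text \<open>The result of a run, together with the number of arithmetic operations and comparisons.\<close>

primrec exec :: "(real, 'a) prog \<Rightarrow> ('a \<times> nat) option" where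
  "exec (Return a) = Some (a, 0)"
| "exec (Const c g) = exec (g (of_int c))"
| "exec (Arith p v w g) =
     (case arith_sem p v w of None \<Rightarrow> None | Some z \<Rightarrow> map_option (apsnd Suc) (exec (g z)))"
| "exec (Compare p v w g) = map_option (apsnd Suc) (exec (g (cmp_sem p v w)))"

abbreviation const :: "int \<Rightarrow> ('v, 'v) prog" where "const c \<equiv> Const c Return"
abbreviation add :: "'v \<Rightarrow> 'v \<Rightarrow> ('v, 'v) prog" where "add v w \<equiv> Arith Add v w Return"
abbreviation sub :: "'v \<Rightarrow> 'v \<Rightarrow> ('v, 'v) prog" where "sub v w \<equiv> Arith Sub v w Return"
abbreviation mul :: "'v \<Rightarrow> 'v \<Rightarrow> ('v, 'v) prog" where "mul v w \<equiv> Arith Mul v w Return"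
abbreviation quot :: "'v \<Rightarrow> 'v \<Rightarrow> ('v, 'v) prog" where "quot v w \<equiv> Arith Div v w Return"
abbreviation less :: "'v \<Rightarrow> 'v \<Rightarrow> ('v, bool) prog" where "less v w \<equiv> Compare Less v w Return"
abbreviation equal :: "'v \<Rightarrow> 'v \<Rightarrow> ('v, bool) prog" where "equal v w \<equiv> Compare Equal v w Return"

primrec map_prog :: "('i \<Rightarrow> ('v, 'a) prog) \<Rightarrow> 'i list \<Rightarrow> ('v, 'a list) prog" where
  "map_prog f [] = Return []"
| "map_prog f (i # is) = do { a \<leftarrow> f i; as \<leftarrow> map_prog f is; Return (a # as) }"

definition vec_prog :: "nat \<Rightarrow> (nat \<Rightarrow> ('v, 'v) prog) \<Rightarrow> ('v, 'v vec) prog" where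
  "vec_prog d f = do { vs \<leftarrow> map_prog f [0..<d]; Return (vec d (\<lambda>i. vs ! i)) }"

definition mat_prog :: "nat \<Rightarrow> nat \<Rightarrow> (nat \<Rightarrow> nat \<Rightarrow> ('v, 'v) prog) \<Rightarrow> ('v, 'v mat) prog" where
  "mat_prog d e f =
     do { vs \<leftarrow> map_prog (\<lambda>r. vec_prog e (f r)) [0..<d]; Return (mat d e (\<lambda>(r, c). vs ! r $ c)) }"

primrec inner_upto :: "nat \<Rightarrow> 'v vec \<Rightarrow> 'v vec \<Rightarrow> ('v, 'v) prog" where
  "inner_upto 0 v w = const 0"
| "inner_upto (Suc i) v w = do { s \<leftarrow> inner_upto i v w; t \<leftarrow> mul (v $ i) (w $ i); add s t }"

definition inner_prog :: "'v vec \<Rightarrow> 'v vec \<Rightarrow> ('v, 'v) prog" where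
  "inner_prog v w = inner_upto (dim_vec w) v w"

definition mat_vec_prog :: "'v mat \<Rightarrow> 'v vec \<Rightarrow> ('v, 'v vec) prog" where
  "mat_vec_prog M v = vec_prog (dim_row M) (\<lambda>i. inner_prog (row M i) v)"

definition vec_mat_prog :: "'v vec \<Rightarrow> 'v mat \<Rightarrow> ('v, 'v vec) prog" where
  "vec_mat_prog v M = vec_prog (dim_col M) (\<lambda>c. inner_prog v (col M c))"

definition vec_eq_prog :: "'v vec \<Rightarrow> 'v vec \<Rightarrow> ('v, bool) prog" where
  "vec_eq_prog v w =
     do { bs \<leftarrow> map_prog (\<lambda>i. equal (v $ i) (w $ i)) [0..<dim_vec w]; Return (list_all id bs) }"


section \<open>The procedure as a program\<close>

text \<open>The row vector \<open>a\<^sup>T(I - AB P)\<close> is evaluated as \<open>a\<^sup>T - (a\<^sup>T AB) P\<close>, without a product of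
  two matrices, and \<open>u\<close> times it divided by \<open>d\<close> is formed entry by entry.\<close>

definition mIRR_independent_prog ::
  "'v mat \<Rightarrow> 'v mat \<Rightarrow> 'v vec \<Rightarrow> 'v vec \<Rightarrow> ('v, 'v mat) prog" where
  "mIRR_independent_prog AB P a u =
    do {
      zero \<leftarrow> const 0;
      h \<leftarrow> vec_mat_prog a AB;
      g \<leftarrow> vec_mat_prog h P;
      q \<leftarrow> vec_prog (dim_vec a) (\<lambda>i. sub (a $ i) (g $ i));
      d \<leftarrow> inner_prog q a;
      mat_prog (dim_row P + 1) (dim_vec a) (\<lambda>r c.
        do { t \<leftarrow> mul (u $ r) (q $ c);
             t' \<leftarrow> quot t d;
             sub (if r < dim_row P then P $$ (r, c) else zero) t' })
    }"

text \<open>The smallest position below the bound that maximises the ratio, and that ratio;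
  \<open>None\<close> if no entry of \<open>u\<close> up to there is negative.\<close>

primrec ratio_upto :: "nat \<Rightarrow> 'v vec \<Rightarrow> 'v vec \<Rightarrow> ('v, (nat \<times> 'v) option) prog" where
  "ratio_upto 0 y u = Return None"
| "ratio_upto (Suc i) y u =
    do {
      best \<leftarrow> ratio_upto i y u;
      zero \<leftarrow> const 0;
      neg \<leftarrow> less (u $ i) zero;
      if neg then
        do {
          t \<leftarrow> quot (y $ i) (u $ i);
          case best of
            None \<Rightarrow> Return (Some (i, t))
          | Some (s, \<theta>) \<Rightarrow> do { b \<leftarrow> less \<theta> t; Return (Some (if b then (i, t) else (s, \<theta>))) }
        }
      else Return best
    }"

definition mIRR_pivot_prog :: "'v mat \<Rightarrow> 'v vec \<Rightarrow> nat \<Rightarrow> ('v, 'v mat) prog" where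
  "mIRR_pivot_prog P u' s =
    do {
      zero \<leftarrow> const 0;
      one \<leftarrow> const 1;
      \<mu> \<leftarrow> vec_prog (dim_row P) (\<lambda>r.
        do { t \<leftarrow> sub (if r = s then one else zero) (u' $ r); quot t (u' $ s) });
      mat_prog (dim_row P) (dim_col P) (\<lambda>r c.
        do { t \<leftarrow> mul (\<mu> $ r) (P $$ (s, c)); add (P $$ (r, c)) t })
    }"

definition mIRR_prog ::
  "'v mat \<Rightarrow> nat list \<Rightarrow> 'v mat \<Rightarrow> nat \<Rightarrow> 'v vec \<Rightarrow> ('v, 'v vec \<times> nat list \<times> 'v mat) prog" where
  "mIRR_prog A B P j x =
    do {
      zero \<leftarrow> const 0;
      one \<leftarrow> const 1;
      minus_one \<leftarrow> const (- 1);
      let n = dim_col A; k = length B; B' = B @ [j];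
          AB = sub_cols (top_row one A) B; a = col (top_row one A) j;
          y = sub_vec x B'
      in do {
        u' \<leftarrow> mat_vec_prog P a;
        let u = u' @\<^sub>v vec 1 (\<lambda>_. minus_one)
        in do {
          w \<leftarrow> mat_vec_prog AB u';
          same \<leftarrow> vec_eq_prog w a;
          if \<not> same then
            do { Q \<leftarrow> mIRR_independent_prog AB P a u; Return (x, B', Q) }
          else
            do {
              best \<leftarrow> ratio_upto (k + 1) y u;
              let s = fst (the best); \<theta> = snd (the best)
              in do {
                z \<leftarrow> vec_prog (k + 1) (\<lambda>i. do { t \<leftarrow> mul \<theta> (u $ i); sub (y $ i) t });
                let xp = scatter zero n B' z
                in if s = k then Return (xp, B, P)
                   else do { Q \<leftarrow> mIRR_pivot_prog P u' s; Return (xp, B[s := j], Q) }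
              }
            }
        }
      }
    }"

end

theory Submission
  imports Defs "Jordan_Normal_Form.Determinant"
begin

text \<open>Let \<open>M\<close> be \<open>A\<^sub>B\<close> and \<open>a\<close> be \<open>A\<^sub>j\<close>, each with a 1 on top of every column. A matrix
  \<open>P\<close> with \<open>P M = I\<close> and \<open>M P\<close> symmetric is the pseudoinverse of \<open>M\<close>, and it exists
  if and only if the columns of \<open>A\<^sub>B\<close> are affinely independent; both branches are
  verified through these two equations.

  If \<open>a\<close> is not in the column space, the residual \<open>q = a - M P a\<close> is orthogonal to that space and
  \<open>q\<^sup>T a = q\<^sup>T q \<noteq> 0\<close>. Appending \<open>a\<close> to \<open>M\<close> adds the symmetric matrix \<open>q q\<^sup>T / q\<^sup>T a\<close> to \<open>M P\<close>.
  Otherwise \<open>M u' = a\<close>, so moving \<open>x\<close> along \<open>u\<close> changes neither \<open>A x\<close> nor the sum of the entries,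
  and the ratio test stops at the first entry that reaches 0. Exchanging the corresponding
  column for \<open>a\<close> keeps the column space, hence \<open>M P\<close>.

  Every step costs at most a constant times \<open>(k + 1) (m + 1)\<close> operations, and \<open>P M = I\<close> forces
  \<open>k \<le> m + 1\<close>.\<close>

section \<open>Operation counts\<close>

text \<open>\<open>T\<close> bounds the count instead of equalling it, so that branches of different
  cost fit one budget. A successful run also certifies that no division by zero occurs.\<close>

definition runs :: "(real, 'a) prog \<Rightarrow> 'a \<Rightarrow> nat \<Rightarrow> bool" where
  "runs p a T \<longleftrightarrow> (\<exists>t\<le>T. exec p = Some (a, t))"

text \<open>Turns the recursion over decision trees into sequential composition with additive
  counts; \<open>runs_bind\<close> is the version for budgets.\<close>

lemma exec_bind:
  "exec (prog_bind p f) =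
     (case exec p of None \<Rightarrow> None | Some (a, t) \<Rightarrow> map_option (apsnd ((+) t)) (exec (f a)))"
proof (induction p)
  case (Return a)
  show ?case by (cases "exec (f a)") auto
next
  case (Compare p v w g)
  then show ?case by (auto simp: option.map_comp o_def split: option.splits intro: option.map_cong)
qed (auto simp: option.map_comp o_def split: option.splits intro: option.map_cong)

lemma runs_mono: "runs p a S \<Longrightarrow> S \<le> T \<Longrightarrow> runs p a T"
  unfolding runs_def using le_trans by blast

lemma runs_bind: "runs p a S \<Longrightarrow> runs (f a) b T \<Longrightarrow> runs (prog_bind p f) b (S + T)"
  unfolding runs_def by (fastforce simp: exec_bind intro: add_mono)

lemma runs_Return: "runs (Return a) a 0"
  by (simp add: runs_def)

lemma runs_const: "runs (const c) (of_int c) 0"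
  by (simp add: runs_def)

lemma runs_add: "runs (add v w) (v + w) 1"
  by (simp add: runs_def)

lemma runs_sub: "runs (sub v w) (v - w) 1"
  by (simp add: runs_def)

lemma runs_mul: "runs (mul v w) (v * w) 1"
  by (simp add: runs_def)

lemma runs_quot: "w \<noteq> 0 \<Longrightarrow> runs (quot v w) (v / w) 1"
  by (simp add: runs_def)

lemma runs_less: "runs (less v w) (v < w) 1"
  by (simp add: runs_def)

lemma runs_equal: "runs (equal v w) (v = w) 1"
  by (simp add: runs_def)

lemma runs_map_prog:
  assumes "\<And>i. i \<in> set is \<Longrightarrow> runs (f i) (g i) T"
  shows "runs (map_prog f is) (map g is) (length is * T)"
  using assms
proof (induction "is")
  case Nil
  show ?case by (simp add: runs_Return)
next
  case (Cons i "is")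
  have "runs (map_prog f (i # is)) (g i # map g is) (T + (length is * T + 0))"
    unfolding map_prog.simps
    by (rule runs_bind runs_Return Cons.IH Cons.prems | simp)+
  then show ?case by simp
qed

lemma runs_vec_prog:
  assumes "\<And>i. i < d \<Longrightarrow> runs (f i) (g i) T"
  shows "runs (vec_prog d f) (vec d g) (d * T)"
proof -
  have "runs (map_prog f [0..<d]) (map g [0..<d]) (length [0..<d] * T)"
    using assms by (intro runs_map_prog) auto
  from runs_bind[OF this runs_Return]
  have "runs (vec_prog d f) (vec d (\<lambda>i. map g [0..<d] ! i)) (d * T)"
    by (simp add: vec_prog_def)
  also have "vec d (\<lambda>i. map g [0..<d] ! i) = vec d g"
    by (intro eq_vecI) auto
  finally show ?thesis .
qed

lemma runs_mat_prog:
  assumes "\<And>r c. r < d \<Longrightarrow> c < e \<Longrightarrow> runs (f r c) (g r c) T"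
  shows "runs (mat_prog d e f) (mat d e (\<lambda>(r, c). g r c)) (d * (e * T))"
proof -
  have "runs (map_prog (\<lambda>r. vec_prog e (f r)) [0..<d]) (map (\<lambda>r. vec e (g r)) [0..<d])
      (length [0..<d] * (e * T))"
    using assms by (intro runs_map_prog runs_vec_prog) auto
  from runs_bind[OF this runs_Return]
  have "runs (mat_prog d e f)
      (mat d e (\<lambda>(r, c). map (\<lambda>r. vec e (g r)) [0..<d] ! r $ c)) (d * (e * T))"
    by (simp add: mat_prog_def)
  also have "mat d e (\<lambda>(r, c). map (\<lambda>r. vec e (g r)) [0..<d] ! r $ c) = mat d e (\<lambda>(r, c). g r c)"
    by (intro eq_matI) auto
  finally show ?thesis .
qed

text \<open>One multiplication and one addition per entry; the sum starts from the free constant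
  0.\<close>

lemma runs_inner_upto: "runs (inner_upto i v w) (\<Sum>l<i. v $ l * w $ l) (2 * i)"
proof (induction i)
  case 0
  show ?case using runs_const[of 0] by simp
next
  case (Suc i)
  have "runs (inner_upto (Suc i) v w) ((\<Sum>l<i. v $ l * w $ l) + v $ i * w $ i) (2 * i + (1 + 1))"
    unfolding inner_upto.simps by (rule runs_bind Suc.IH runs_mul runs_add)+
  then show ?case by simp
qed

lemma runs_inner_prog: "runs (inner_prog v w) (v \<bullet> w) (2 * dim_vec w)"
  using runs_inner_upto[of "dim_vec w" v w]
  by (simp add: inner_prog_def scalar_prod_def atLeast0LessThan)

lemma runs_mat_vec_prog:
  "runs (mat_vec_prog M v) (M *\<^sub>v v) (dim_row M * (2 * dim_vec v))"
  unfolding mat_vec_prog_def mult_mat_vec_def by (intro runs_vec_prog runs_inner_prog)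

lemma runs_vec_mat_prog:
  "runs (vec_mat_prog v M) (vec (dim_col M) (\<lambda>c. v \<bullet> col M c)) (dim_col M * (2 * dim_row M))"
  unfolding vec_mat_prog_def
  by (intro runs_vec_prog runs_mono[OF runs_inner_prog]) auto

lemma runs_vec_eq_prog:
  assumes "dim_vec v = dim_vec w"
  shows "runs (vec_eq_prog v w) (v = w) (dim_vec w)"
proof -
  have "runs (map_prog (\<lambda>i. equal (v $ i) (w $ i)) [0..<dim_vec w])
      (map (\<lambda>i. v $ i = w $ i) [0..<dim_vec w]) (length [0..<dim_vec w] * 1)"
    by (intro runs_map_prog runs_equal)
  from runs_bind[OF this runs_Return]
  have "runs (vec_eq_prog v w)
      (list_all id (map (\<lambda>i. v $ i = w $ i) [0..<dim_vec w])) (dim_vec w)"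
    by (simp add: vec_eq_prog_def)
  also have "list_all id (map (\<lambda>i. v $ i = w $ i) [0..<dim_vec w]) \<longleftrightarrow> v = w"
    using assms by (auto simp: list_all_iff intro: eq_vecI)
  finally show ?thesis .
qed

section \<open>The ratio test\<close>

text \<open>Tie-breaking is encoded by the strict inequality before \<open>s\<close>: it makes
  \<open>s\<close> the smallest maximiser.\<close>

fun ratio_spec :: "nat \<Rightarrow> real vec \<Rightarrow> real vec \<Rightarrow> (nat \<times> real) option \<Rightarrow> bool" where
  "ratio_spec i y u None \<longleftrightarrow> (\<forall>l<i. 0 \<le> u $ l)"
| "ratio_spec i y u (Some (s, \<theta>)) \<longleftrightarrow>
     s < i \<and> u $ s < 0 \<and> \<theta> = y $ s / u $ s \<and>
     (\<forall>l<i. u $ l < 0 \<longrightarrow> y $ l / u $ l \<le> \<theta>) \<and>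
     (\<forall>l<s. u $ l < 0 \<longrightarrow> y $ l / u $ l < \<theta>)"

lemma runs_ratio_upto: "\<exists>b. runs (ratio_upto i y u) b (3 * i) \<and> ratio_spec i y u b"
proof (induction i)
  case 0
  show ?case by (auto simp: runs_Return intro!: exI[of _ None])
next
  case (Suc i)
  then obtain b where run: "runs (ratio_upto i y u) b (3 * i)" and spec: "ratio_spec i y u b"
    by blast
  define t where "t = y $ i / u $ i"
  \<comment> \<open>The updated best pair; as the comparison is strict, a tie keeps the earlier
    position.\<close>
  define b' where "b' =
    (if u $ i < 0 then
       (case b of None \<Rightarrow> Some (i, t)
        | Some (s, \<theta>) \<Rightarrow> Some (if \<theta> < t then (i, t) else (s, \<theta>)))
     else b)"
  \<comment> \<open>The three new operations are the sign test, the quotient and the comparison with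
    the best ratio so far.\<close>
  have "runs (ratio_upto (Suc i) y u) b' (3 * i + (0 + (1 + (1 + 1))))"
    unfolding ratio_upto.simps
  proof (rule runs_bind[OF run], rule runs_bind[OF runs_const], rule runs_bind[OF runs_less])
    show "runs (if u $ i < of_int 0 then
        quot (y $ i) (u $ i) \<bind>
          (\<lambda>t. case b of None \<Rightarrow> Return (Some (i, t))
             | Some (s, \<theta>) \<Rightarrow> less \<theta> t \<bind> (\<lambda>b. Return (Some (if b then (i, t) else (s, \<theta>)))))
        else Return b) b' (1 + 1)"
    proof (cases "u $ i < 0")
      case True
      show ?thesis
      proof (cases b)
        case None
        then show ?thesis
          using True by (auto simp: b'_def runs_def t_def)
      next
        case (Some p)
        obtain s \<theta> where p: "p = (s, \<theta>)" by force
        then show ?thesis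
          using True Some by (auto simp: b'_def runs_def t_def)
      qed
    next
      case False
      then show ?thesis by (simp add: b'_def runs_mono[OF runs_Return])
    qed
  qed
  moreover have "ratio_spec (Suc i) y u b'"
  proof (cases b)
    case None
    then show ?thesis using spec by (auto simp: b'_def t_def less_Suc_eq not_less)
  next
    case (Some p)
    obtain s \<theta> where p: "p = (s, \<theta>)" by force
    then show ?thesis
      using spec Some by (fastforce simp: b'_def t_def less_Suc_eq not_less)
  qed
  ultimately show ?case by (auto simp: numeral_3_eq_3)
qed

lemma ratio_spec_None: "ratio_spec i y u b \<Longrightarrow> l < i \<Longrightarrow> u $ l < 0 \<Longrightarrow> b \<noteq> None"
  by (cases b) fastforce+

lemma mIRR_theta_eq:
  assumes "ratio_spec (length B') (sub_vec x B') u (Some (s, \<theta>))"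
  shows "mIRR_theta B' u x = \<theta>"
  unfolding mIRR_theta_def
proof (rule Max_eqI)
  have "finite ((\<lambda>i. x $ (B' ! i) / u $ i) ` {..<length B'})" by simp
  then show "finite {x $ (B' ! i) / u $ i |i. i < length B' \<and> u $ i < 0}"
    by (rule rev_finite_subset) auto
qed (use assms in \<open>auto simp: sub_vec_def\<close>)

lemma mIRR_leaving_eq:
  assumes "ratio_spec (length B') (sub_vec x B') u (Some (s, \<theta>))"
  shows "mIRR_leaving B' u x = s"
  unfolding mIRR_leaving_def mIRR_theta_eq[OF assms]
proof (rule Least_equality)
  fix i assume "i < length B' \<and> u $ i < 0 \<and> x $ (B' ! i) / u $ i = \<theta>"
  then show "s \<le> i"
    using assms by (force simp: sub_vec_def not_less[symmetric])
qed (use assms in \<open>auto simp: sub_vec_def\<close>)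

section \<open>Pseudoinverses\<close>

text \<open>The second and third conditions determine \<open>P = (M\<^sup>T M)\<^sup>-\<^sup>1 M\<^sup>T\<close>: they give
  \<open>P = P M P = P (M P)\<^sup>T = (P P\<^sup>T) M\<^sup>T\<close>, and \<open>P P\<^sup>T\<close> is a left inverse of \<open>M\<^sup>T M\<close>.\<close>

definition is_pinv :: "real mat \<Rightarrow> real mat \<Rightarrow> bool" where
  "is_pinv M P \<longleftrightarrow> P \<in> carrier_mat (dim_col M) (dim_row M) \<and>
     P * M = 1\<^sub>m (dim_col M) \<and> (M * P)\<^sup>T = M * P"

lemma pinv_eqI:
  assumes "is_pinv M P"
  shows "pinv M = P"
proof -
  define r k where "r = dim_row M" and "k = dim_col M"
  have M: "M \<in> carrier_mat r k" and P: "P \<in> carrier_mat k r"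
    and PM: "P * M = 1\<^sub>m k" and sym: "(M * P)\<^sup>T = M * P"
    using assms by (auto simp: is_pinv_def r_def k_def)
  have X: "P * P\<^sup>T \<in> carrier_mat k k" and G: "M\<^sup>T * M \<in> carrier_mat k k"
    using M P by auto
  have PX: "P * P\<^sup>T * M\<^sup>T = P"
  proof -
    have "P * P\<^sup>T * M\<^sup>T = P * (M * P)\<^sup>T"
      using M P by (simp add: assoc_mult_mat[of _ k r _ k _ r] transpose_mult[OF M P])
    also have "\<dots> = P * M * P"
      using M P by (simp add: sym assoc_mult_mat[of _ k r _ k _ r])
    finally show ?thesis using P by (simp add: PM)
  qed
  have XG: "P * P\<^sup>T * (M\<^sup>T * M) = 1\<^sub>m k"
    using M P X PX PM assoc_mult_mat[OF X, of "M\<^sup>T" r M k] by simp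
  \<comment> \<open>A one-sided inverse of a square matrix is two-sided, so the Gram matrix is a
    unit and \<open>mat_inverse\<close> cannot fail.\<close>
  have "mat_inverse (M\<^sup>T * M) \<noteq> None"
    using mat_inverse(1)[OF G, of "()"] XG mat_mult_left_right_inverse[OF X G XG] X G
    by (auto simp: Units_def ring_mat_def)
  then obtain Y where Y: "mat_inverse (M\<^sup>T * M) = Some Y" by auto
  from mat_inverse(2)[OF G Y] have GY: "M\<^sup>T * M * Y = 1\<^sub>m k" and Yc: "Y \<in> carrier_mat k k"
    by auto
  \<comment> \<open>Uniqueness of inverses: the matrix found by \<open>mat_inverse\<close> is
    \<open>P * P\<^sup>T\<close>.\<close>
  have "Y = P * P\<^sup>T * (M\<^sup>T * M) * Y" using Yc by (simp add: XG)
  also have "\<dots> = P * P\<^sup>T * (M\<^sup>T * M * Y)" by (rule assoc_mult_mat[OF X G Yc])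
  also have "\<dots> = P * P\<^sup>T" by (simp only: GY right_mult_one_mat[OF X])
  finally show ?thesis by (simp add: pinv_def Y PX)
qed

lemma scalar_prod_self_eq_0:
  fixes v :: "real vec"
  shows "v \<bullet> v = 0 \<longleftrightarrow> v = 0\<^sub>v (dim_vec v)"
proof
  assume "v \<bullet> v = 0"
  then have "\<forall>i\<in>{0..<dim_vec v}. v $ i * v $ i = 0"
    by (subst sum_nonneg_eq_0_iff[symmetric]) (auto simp: scalar_prod_def)
  then show "v = 0\<^sub>v (dim_vec v)" by (intro eq_vecI) auto
next
  assume v: "v = 0\<^sub>v (dim_vec v)"
  show "v \<bullet> v = 0" by (subst v) (simp add: scalar_prod_def)
qed

text \<open>Injectivity of \<open>M\<close> makes the Gram matrix \<open>M\<^sup>T * M\<close>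
  nonsingular. Its inverse inherits its symmetry, which yields the symmetry of
  \<open>M * pinv M\<close>.\<close>

lemma is_pinv_pinv:
  fixes M :: "real mat"
  assumes inj: "\<And>v. v \<in> carrier_vec (dim_col M) \<Longrightarrow> M *\<^sub>v v = 0\<^sub>v (dim_row M) \<Longrightarrow>
    v = 0\<^sub>v (dim_col M)"
  shows "is_pinv M (pinv M)"
proof -
  define r k where "r = dim_row M" and "k = dim_col M"
  have M: "M \<in> carrier_mat r k" by (simp add: r_def k_def)
  have G: "M\<^sup>T * M \<in> carrier_mat k k" using M by auto
  have "det (M\<^sup>T * M) \<noteq> 0"
  proof
    assume "det (M\<^sup>T * M) = 0"
    then obtain v where v: "v \<in> carrier_vec k" "v \<noteq> 0\<^sub>v k" and Gv: "M\<^sup>T * M *\<^sub>v v = 0\<^sub>v k"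
      using det_0_iff_vec_prod_zero_field[OF G] by auto
    \<comment> \<open>For a kernel vector of the Gram matrix, the squared norm of \<open>M v\<close>
      is \<open>v\<^sup>T M\<^sup>T M v = 0\<close>.\<close>
    have "(M *\<^sub>v v) \<bullet> (M *\<^sub>v v) = (M\<^sup>T *\<^sub>v (M *\<^sub>v v)) \<bullet> v"
      using M v transpose_vec_mult_scalar[OF M v(1), of "M *\<^sub>v v"] by simp
    also have "M\<^sup>T *\<^sub>v (M *\<^sub>v v) = 0\<^sub>v k"
      using M v Gv assoc_mult_mat_vec[of "M\<^sup>T" k r M k v] by simp
    finally have "(M *\<^sub>v v) \<bullet> (M *\<^sub>v v) = 0" using v by simp
    then have "M *\<^sub>v v = 0\<^sub>v (dim_row M)" by (simp add: scalar_prod_self_eq_0)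
    with inj[of v] v show False by (simp add: k_def)
  qed
  from det_non_zero_imp_unit[OF G this, of "()"] mat_inverse(1)[OF G, of "()"]
  obtain Y where Y: "mat_inverse (M\<^sup>T * M) = Some Y" by fastforce
  from mat_inverse(2)[OF G Y] have GY: "M\<^sup>T * M * Y = 1\<^sub>m k" and YG: "Y * (M\<^sup>T * M) = 1\<^sub>m k"
    and Yc: "Y \<in> carrier_mat k k" by auto
  have p: "pinv M = Y * M\<^sup>T" by (simp add: pinv_def Y)
  \<comment> \<open>Transposing the equation for the right inverse shows that
    \<open>Y\<^sup>T\<close> is a left inverse, hence equal to \<open>Y\<close>.\<close>
  have YtG: "Y\<^sup>T * (M\<^sup>T * M) = 1\<^sub>m k"
    using arg_cong[OF GY, of transpose_mat] M Yc transpose_mult[OF G Yc] transpose_mult[of "M\<^sup>T" k r M k]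
    by simp
  have "Y\<^sup>T = Y\<^sup>T * (M\<^sup>T * M * Y)" using Yc by (simp add: GY)
  also have "\<dots> = Y\<^sup>T * (M\<^sup>T * M) * Y"
    by (rule assoc_mult_mat[symmetric, of _ k k _ k _ k]) (use Yc G in auto)
  also have "\<dots> = Y" using Yc by (simp add: YtG)
  finally have Yt: "Y\<^sup>T = Y" .
  have YM: "Y * M\<^sup>T \<in> carrier_mat k r" using Yc M by auto
  have "(M * (Y * M\<^sup>T))\<^sup>T = (Y * M\<^sup>T)\<^sup>T * M\<^sup>T" by (rule transpose_mult[OF M YM])
  also have "(Y * M\<^sup>T)\<^sup>T = M * Y" using transpose_mult[OF Yc, of "M\<^sup>T" r] M Yt by simp
  also have "M * Y * M\<^sup>T = M * (Y * M\<^sup>T)"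
    by (rule assoc_mult_mat[of _ r k _ k _ r]) (use Yc M in auto)
  finally have "(M * (Y * M\<^sup>T))\<^sup>T = M * (Y * M\<^sup>T)" .
  moreover have "Y * M\<^sup>T * M = 1\<^sub>m k"
    using YG assoc_mult_mat[of Y k k "M\<^sup>T" r M k] Yc M by simp
  ultimately show ?thesis using YM by (simp add: is_pinv_def p r_def k_def)
qed

text \<open>A left inverse recovers \<open>v\<close> as \<open>P (M v)\<close>; with
  \<open>is_pinv_pinv\<close> this identifies injectivity with the existence of
  \<open>P\<close>.\<close>

lemma is_pinv_inj:
  assumes "is_pinv M P" "v \<in> carrier_vec (dim_col M)" "M *\<^sub>v v = 0\<^sub>v (dim_row M)"
  shows "v = 0\<^sub>v (dim_col M)"
proof -
  have P: "P \<in> carrier_mat (dim_col M) (dim_row M)" and PM: "P * M = 1\<^sub>m (dim_col M)"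
    using assms(1) by (auto simp: is_pinv_def)
  have "v = P * M *\<^sub>v v" using assms(2) by (simp add: PM)
  also have "\<dots> = P *\<^sub>v (M *\<^sub>v v)" using assoc_mult_mat_vec[OF P _ assms(2)] by simp
  also have "\<dots> = 0\<^sub>v (dim_col M)" using P unfolding assms(3)
    by (intro eq_vecI) (auto simp: scalar_prod_def)
  finally show ?thesis .
qed

text \<open>If \<open>r < k\<close>, zero padding makes both matrices square without changing the
  product. A left inverse of a square matrix is also a right inverse, but row \<open>r\<close> of
  the padded \<open>M\<close> is zero.\<close>

lemma left_inverse_dim_le:
  fixes M P :: "'a :: field mat"
  assumes M: "M \<in> carrier_mat r k" and P: "P \<in> carrier_mat k r" and PM: "P * M = 1\<^sub>m k"
  shows "k \<le> r"
proof (rule ccontr)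
  assume "\<not> k \<le> r"
  then have rk: "r < k" by simp
  define M' where "M' = mat k k (\<lambda>(i, c). if i < r then M $$ (i, c) else 0)"
  define P' where "P' = mat k k (\<lambda>(i, c). if c < r then P $$ (i, c) else 0)"
  have c: "P' \<in> carrier_mat k k" "M' \<in> carrier_mat k k" by (auto simp: P'_def M'_def)
  have "P' * M' = P * M"
  proof (intro eq_matI)
    fix i l assume "i < dim_row (P * M)" "l < dim_col (P * M)"
    then have il: "i < k" "l < k" using M P by auto
    have "(P' * M') $$ (i, l) =
        (\<Sum>c\<in>{0..<k}. if c < r then P $$ (i, c) * M $$ (c, l) else 0)"
      using il by (auto simp: P'_def M'_def scalar_prod_def intro!: sum.cong)
    also have "\<dots> = (\<Sum>c\<in>{0..<r}. P $$ (i, c) * M $$ (c, l))"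
      using rk by (intro sum.mono_neutral_cong_right) auto
    also have "\<dots> = (P * M) $$ (i, l)"
      using il M P by (auto simp: scalar_prod_def intro!: sum.cong)
    finally show "(P' * M') $$ (i, l) = (P * M) $$ (i, l)" .
  qed (use c M P in auto)
  then have "M' * P' = 1\<^sub>m k"
    using mat_mult_left_right_inverse[OF c] PM by simp
  then have "(M' * P') $$ (r, r) = 1" using rk by simp
  moreover have "(M' * P') $$ (r, r) = 0" using rk by (simp add: M'_def P'_def scalar_prod_def)
  ultimately show False by simp
qed

section \<open>Updating the pseudoinverse when a column is appended or exchanged\<close>

definition append_col :: "'a mat \<Rightarrow> 'a vec \<Rightarrow> 'a mat" where
  "append_col M a = mat (dim_row M) (dim_col M + 1) (\<lambda>(r, c). if c < dim_col M then M $$ (r, c) else a $ r)"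

definition replace_col :: "'a mat \<Rightarrow> nat \<Rightarrow> 'a vec \<Rightarrow> 'a mat" where
  "replace_col M s a = mat (dim_row M) (dim_col M) (\<lambda>(r, c). if c = s then a $ r else M $$ (r, c))"

lemma index_mult_mat_sum:
  assumes "A \<in> carrier_mat r k" "B \<in> carrier_mat k c" "i < r" "l < c"
  shows "(A * B) $$ (i, l) = (\<Sum>t<k. A $$ (i, t) * B $$ (t, l))"
  using assms by (auto simp: scalar_prod_def atLeast0LessThan intro!: sum.cong)

lemma index_mult_mat_vec_sum:
  assumes "A \<in> carrier_mat r k" "v \<in> carrier_vec k" "i < r"
  shows "(A *\<^sub>v v) $ i = (\<Sum>t<k. A $$ (i, t) * v $ t)"
  using assms by (auto simp: scalar_prod_def atLeast0LessThan intro!: sum.cong)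

lemma sum_lessThan_one:
  fixes k :: nat
  assumes "l < k"
  shows "(\<Sum>c<k. f c * (if c = l then 1 else 0)) = (f l :: 'a :: semiring_1)"
  using assms by (simp add: if_distrib cong: if_cong)

text \<open>\<open>M P\<close> is symmetric and fixes the column space, so \<open>M P a\<close> and
  \<open>a\<close> have the same inner product with every \<open>M v\<close>.\<close>

lemma residual_orthogonal:
  assumes M: "M \<in> carrier_mat r k" and pi: "is_pinv M P" and a: "a \<in> carrier_vec r"
    and v: "v \<in> carrier_vec k"
  shows "(a - M *\<^sub>v (P *\<^sub>v a)) \<bullet> (M *\<^sub>v v) = 0"
proof -
  have P: "P \<in> carrier_mat k r" and PM: "P * M = 1\<^sub>m k" and sym: "(M * P)\<^sup>T = M * P"
    using M pi by (auto simp: is_pinv_def)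
  have MP: "M * P \<in> carrier_mat r r" and Mv: "M *\<^sub>v v \<in> carrier_vec r" using M P v by auto
  have "(M *\<^sub>v (P *\<^sub>v a)) \<bullet> (M *\<^sub>v v) = ((M * P)\<^sup>T *\<^sub>v a) \<bullet> (M *\<^sub>v v)"
    using M P a by (simp add: sym assoc_mult_mat_vec[OF M P a])
  also have "\<dots> = a \<bullet> (M * P *\<^sub>v (M *\<^sub>v v))"
    using transpose_vec_mult_scalar[OF MP Mv a] by simp
  also have "M * P *\<^sub>v (M *\<^sub>v v) = M *\<^sub>v (P * M *\<^sub>v v)"
    using assoc_mult_mat_vec[OF M P Mv] assoc_mult_mat_vec[OF P M v] by simp
  also have "\<dots> = M *\<^sub>v v" using v by (simp add: PM)
  finally show ?thesis
    using minus_scalar_prod_distrib[of a r "M *\<^sub>v (P *\<^sub>v a)" "M *\<^sub>v v"] M P a v by simp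
qed

lemma residual_scalar_prod:
  assumes M: "M \<in> carrier_mat r k" and pi: "is_pinv M P" and a: "a \<in> carrier_vec r"
    and q: "q = a - M *\<^sub>v (P *\<^sub>v a)"
  shows "q \<bullet> a = q \<bullet> q"
proof -
  have P: "P \<in> carrier_mat k r" using M pi by (auto simp: is_pinv_def)
  have "q \<bullet> q = q \<bullet> (a - M *\<^sub>v (P *\<^sub>v a))" by (simp add: q)
  also have "\<dots> = q \<bullet> a - q \<bullet> (M *\<^sub>v (P *\<^sub>v a))"
    by (rule scalar_prod_minus_distrib[of _ r]) (use M P a q in auto)
  also have "q \<bullet> (M *\<^sub>v (P *\<^sub>v a)) = 0"
    unfolding q using residual_orthogonal[OF M pi a] P a by simp
  finally show ?thesis by simp
qed

text \<open>The inner product is the squared norm of the residual, which vanishes only if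
  \<open>a\<close> equals its projection. This justifies dividing by it, in the formula and in the
  program.\<close>

lemma residual_scalar_prod_neq_0:
  assumes M: "M \<in> carrier_mat r k" and pi: "is_pinv M P" and a: "a \<in> carrier_vec r"
    and q: "q = a - M *\<^sub>v (P *\<^sub>v a)" and neq: "M *\<^sub>v (P *\<^sub>v a) \<noteq> a"
  shows "q \<bullet> a \<noteq> 0"
proof
  assume "q \<bullet> a = 0"
  then have "q = 0\<^sub>v (dim_vec q)"
    using residual_scalar_prod[OF assms(1-4)] scalar_prod_self_eq_0[of q] by simp
  then have "\<forall>i<r. q $ i = 0"
    using M q by (metis carrier_matD(1) dim_mult_mat_vec index_minus_vec(2) index_zero_vec(1))
  then have "M *\<^sub>v (P *\<^sub>v a) = a" using M a by (intro eq_vecI) (auto simp: q)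
  with neq show False by simp
qed

text \<open>The given matrix is the block formula of the procedure, entry by entry:
  \<open>u q\<^sup>T / (q\<^sup>T a)\<close> is subtracted from \<open>P\<close> with a zero row
  below.\<close>

lemma is_pinv_append_col:
  assumes M: "M \<in> carrier_mat r k" and pi: "is_pinv M P" and a: "a \<in> carrier_vec r"
    and neq: "M *\<^sub>v (P *\<^sub>v a) \<noteq> a"
    and q: "q = a - M *\<^sub>v (P *\<^sub>v a)"
    and u: "u = P *\<^sub>v a @\<^sub>v vec 1 (\<lambda>_. - 1)"
  shows "is_pinv (append_col M a)
    (mat (k + 1) r (\<lambda>(i, c). (if i < k then P $$ (i, c) else 0) - u $ i * q $ c / (q \<bullet> a)))"
    (is "is_pinv ?M ?P")
proof -
  have P: "P \<in> carrier_mat k r" and PM: "P * M = 1\<^sub>m k" and sym: "(M * P)\<^sup>T = M * P"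
    using M pi by (auto simp: is_pinv_def)
  have MP: "M * P \<in> carrier_mat r r" using M P by auto
  define d where "d = q \<bullet> a"
  have d: "d \<noteq> 0" unfolding d_def by (rule residual_scalar_prod_neq_0[OF M pi a q neq])
  have M': "?M \<in> carrier_mat r (k + 1)" and P': "?P \<in> carrier_mat (k + 1) r"
    using M by (auto simp: append_col_def)
  \<comment> \<open>\<open>q\<close> annihilates the old columns, so the correction does not disturb
    \<open>P M = I\<close>.\<close>
  have qM: "(\<Sum>c<r. q $ c * M $$ (c, l)) = 0" if "l < k" for l
  proof -
    have "q \<bullet> (M *\<^sub>v unit_vec k l) = 0"
      unfolding q by (rule residual_orthogonal[OF M pi a]) simp
    moreover have "M *\<^sub>v unit_vec k l = col M l"
      using M that by (intro eq_vecI) auto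
    moreover have "(\<Sum>c<r. q $ c * M $$ (c, l)) = q \<bullet> col M l"
      using M that by (auto simp: scalar_prod_def atLeast0LessThan intro!: sum.cong)
    ultimately show ?thesis by simp
  qed
  have qa: "(\<Sum>c<r. q $ c * a $ c) = d"
    using a by (simp add: d_def scalar_prod_def atLeast0LessThan)
  have Pa: "(\<Sum>c<r. P $$ (i, c) * a $ c) = (P *\<^sub>v a) $ i" if "i < k" for i
    using index_mult_mat_vec_sum[OF P a that] by simp
  have PMi: "(\<Sum>c<r. P $$ (i, c) * M $$ (c, l)) = (if i = l then 1 else 0)" if "i < k" "l < k" for i l
    using index_mult_mat_sum[OF P M that] that by (simp add: PM)
  have "?P * ?M = 1\<^sub>m (k + 1)"
  proof (intro eq_matI)
    fix i l assume "i < dim_row (1\<^sub>m (k + 1) :: real mat)" "l < dim_col (1\<^sub>m (k + 1) :: real mat)"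
    then have il: "i < k + 1" "l < k + 1" by auto
    define b where "b c = ?M $$ (c, l)" for c
    have "(?P * ?M) $$ (i, l) = (\<Sum>c<r. ?P $$ (i, c) * b c)"
      unfolding b_def by (rule index_mult_mat_sum[OF P' M' il])
    also have "\<dots> = (\<Sum>c<r. (if i < k then P $$ (i, c) * b c else 0) - u $ i / d * (q $ c * b c))"
      using il by (intro sum.cong) (auto simp: d_def algebra_simps)
    also have "\<dots> = (\<Sum>c<r. if i < k then P $$ (i, c) * b c else 0) - u $ i / d * (\<Sum>c<r. q $ c * b c)"
      by (simp add: sum_subtractf sum_distrib_left)
    \<comment> \<open>On an old column the correction vanishes. On the new one it subtracts exactly
      \<open>u $ i\<close>, which leaves 0 for \<open>i < k\<close> and 1 in the last row, since the
      last entry of \<open>u\<close> is -1.\<close>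
    also have "\<dots> = (if i = l then 1 else 0)"
    proof (cases "l < k")
      case True
      then have b: "b c = M $$ (c, l)" if "c < r" for c
        using that M by (auto simp: b_def append_col_def)
      show ?thesis using True il qM[of l] PMi[of i l] by (cases "i < k") (auto simp: b)
    next
      case False
      then have "l = k" using il by simp
      then have b: "b c = a $ c" if "c < r" for c
        using that M by (auto simp: b_def append_col_def)
      show ?thesis using \<open>l = k\<close> il qa Pa[of i] d P by (cases "i < k") (auto simp: b u)
    qed
    finally show "(?P * ?M) $$ (i, l) = 1\<^sub>m (k + 1) $$ (i, l)" using il by simp
  qed (use M' P' in auto)
  moreover have "(?M * ?P)\<^sup>T = ?M * ?P"
  proof -
    \<comment> \<open>The corrections collect into \<open>(a - M P a) q\<^sup>T / d\<close>, which
      is symmetric because its first factor is \<open>q\<close>.\<close>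
    have MPij: "(?M * ?P) $$ (i, l) = (M * P) $$ (i, l) + q $ i * q $ l / d" if il: "i < r" "l < r" for i l
    proof -
      have "(?M * ?P) $$ (i, l) = (\<Sum>t<k + 1. ?M $$ (i, t) * ?P $$ (t, l))"
        by (rule index_mult_mat_sum[OF M' P' il])
      also have "\<dots> = (\<Sum>t<k. M $$ (i, t) * (P $$ (t, l) - (P *\<^sub>v a) $ t * q $ l / d)) + a $ i * q $ l / d"
        using il M P by (simp add: append_col_def u d_def cong: sum.cong_simp)
      also have "(\<Sum>t<k. M $$ (i, t) * (P $$ (t, l) - (P *\<^sub>v a) $ t * q $ l / d)) =
          (\<Sum>t<k. M $$ (i, t) * P $$ (t, l)) - (\<Sum>t<k. M $$ (i, t) * (P *\<^sub>v a) $ t) * q $ l / d"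
        by (simp add: algebra_simps sum_subtractf sum_distrib_right sum_distrib_left sum_divide_distrib)
      also have "(\<Sum>t<k. M $$ (i, t) * P $$ (t, l)) = (M * P) $$ (i, l)"
        using index_mult_mat_sum[OF M P il] by simp
      also have "(\<Sum>t<k. M $$ (i, t) * (P *\<^sub>v a) $ t) = (M *\<^sub>v (P *\<^sub>v a)) $ i"
        using index_mult_mat_vec_sum[OF M _ il(1), of "P *\<^sub>v a"] P a by simp
      also have "\<dots> = a $ i - q $ i" using il a M unfolding q by simp
      finally show ?thesis by (simp add: diff_divide_distrib left_diff_distrib)
    qed
    show ?thesis
    proof (intro eq_matI)
      fix i l assume "i < dim_row (?M * ?P)" "l < dim_col (?M * ?P)"
      then have il: "i < r" "l < r" using M' by auto
      have "(M * P) $$ (l, i) = (M * P)\<^sup>T $$ (i, l)" using il MP by (metis index_transpose_mat(1) carrier_matD)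
      then show "(?M * ?P)\<^sup>T $$ (i, l) = (?M * ?P) $$ (i, l)"
        using il M' P' MPij by (simp add: sym del: index_mult_mat(1))
    qed (use M' P' in auto)
  qed
  ultimately show ?thesis using M' P' unfolding is_pinv_def by auto
qed

text \<open>\<open>\<mu>\<close> is chosen such that \<open>u $ i + \<mu> i * u $ s\<close> is the
  unit vector at \<open>s\<close>. As \<open>P a = u\<close>, the new column is sent there, while
  the other columns are unaffected because row \<open>s\<close> of \<open>P\<close> annihilates
  them.\<close>

lemma is_pinv_replace_col:
  assumes M: "M \<in> carrier_mat r k" and pi: "is_pinv M P" and a: "a \<in> carrier_vec r"
    and u: "u \<in> carrier_vec k" and Mu: "M *\<^sub>v u = a" and s: "s < k" and us: "u $ s \<noteq> 0"
    and \<mu>: "\<And>i. i < k \<Longrightarrow> \<mu> i = ((if i = s then 1 else 0) - u $ i) / u $ s"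
  shows "is_pinv (replace_col M s a) (mat k r (\<lambda>(i, c). P $$ (i, c) + \<mu> i * P $$ (s, c)))"
    (is "is_pinv ?M ?P")
proof -
  have P: "P \<in> carrier_mat k r" and PM: "P * M = 1\<^sub>m k" and sym: "(M * P)\<^sup>T = M * P"
    using M pi by (auto simp: is_pinv_def)
  have M': "?M \<in> carrier_mat r k" and P': "?P \<in> carrier_mat k r"
    using M by (auto simp: replace_col_def)
  have "P *\<^sub>v a = u" using assoc_mult_mat_vec[OF P M u] u by (simp add: PM Mu)
  then have Pa: "(\<Sum>c<r. P $$ (i, c) * a $ c) = u $ i" if "i < k" for i
    using index_mult_mat_vec_sum[OF P a that] by simp
  have PMi: "(\<Sum>c<r. P $$ (i, c) * M $$ (c, l)) = (if i = l then 1 else 0)" if "i < k" "l < k" for i l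
    using index_mult_mat_sum[OF P M that] that by (simp add: PM)
  have "?P * ?M = 1\<^sub>m k"
  proof (intro eq_matI)
    fix i l assume "i < dim_row (1\<^sub>m k :: real mat)" "l < dim_col (1\<^sub>m k :: real mat)"
    then have il: "i < k" "l < k" by auto
    define b where "b c = ?M $$ (c, l)" for c
    have "(?P * ?M) $$ (i, l) = (\<Sum>c<r. ?P $$ (i, c) * b c)"
      unfolding b_def by (rule index_mult_mat_sum[OF P' M' il])
    also have "\<dots> = (\<Sum>c<r. P $$ (i, c) * b c) + \<mu> i * (\<Sum>c<r. P $$ (s, c) * b c)"
      using il by (simp add: algebra_simps sum.distrib sum_distrib_left)
    also have "\<dots> = (if i = l then 1 else 0)"
    proof (cases "l = s")
      case True
      then have b: "b c = a $ c" if "c < r" for c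
        using that M s by (auto simp: b_def replace_col_def)
      show ?thesis using il s us Pa \<mu> True by (simp add: b)
    next
      case False
      then have b: "b c = M $$ (c, l)" if "c < r" for c
        using that M il by (auto simp: b_def replace_col_def)
      show ?thesis using il s PMi False by (simp add: b)
    qed
    finally show "(?P * ?M) $$ (i, l) = 1\<^sub>m k $$ (i, l)" using il by simp
  qed (use M' P' in auto)
  moreover have "?M * ?P = M * P"
  proof (intro eq_matI)
    fix i l assume "i < dim_row (M * P)" "l < dim_col (M * P)"
    then have il: "i < r" "l < r" using M P by auto
    have Mu_i: "(\<Sum>t<k. M $$ (i, t) * u $ t) = a $ i"
      using index_mult_mat_vec_sum[OF M u il(1)] by (simp add: Mu)
    have "(\<Sum>t<k. M $$ (i, t) * \<mu> t) =
        (\<Sum>t<k. (M $$ (i, t) * (if t = s then 1 else 0) - M $$ (i, t) * u $ t) / u $ s)"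
      by (intro sum.cong) (auto simp: \<mu> right_diff_distrib)
    also have "\<dots> = (M $$ (i, s) - a $ i) / u $ s"
      using s Mu_i by (simp add: sum_divide_distrib[symmetric] sum_subtractf sum_lessThan_one)
    finally have M\<mu>: "(\<Sum>t<k. M $$ (i, t) * \<mu> t) = (M $$ (i, s) - a $ i) / u $ s" .
    have \<mu>s: "1 + \<mu> s = 1 / u $ s" 
      unfolding \<mu>[OF s] using us by (simp add: diff_divide_distrib)
    have "(?M * ?P) $$ (i, l) = (\<Sum>t<k. ?M $$ (i, t) * ?P $$ (t, l))"
      by (rule index_mult_mat_sum[OF M' P' il])
    \<comment> \<open>Expands \<open>(M + (a - M e\<^sub>s) e\<^sub>s\<^sup>T) (P + \<mu>
      e\<^sub>s\<^sup>T P)\<close>; the indicator factor isolates the contribution of the exchanged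
      column.\<close>
    also have "\<dots> = (\<Sum>t<k. M $$ (i, t) * P $$ (t, l) + M $$ (i, t) * \<mu> t * P $$ (s, l)
        + (a $ i - M $$ (i, s)) * (1 + \<mu> t) * P $$ (s, l) * (if t = s then 1 else 0))"
      using il M by (intro sum.cong) (auto simp: replace_col_def algebra_simps)
    also have "\<dots> = (\<Sum>t<k. M $$ (i, t) * P $$ (t, l)) + (\<Sum>t<k. M $$ (i, t) * \<mu> t) * P $$ (s, l)
        + (a $ i - M $$ (i, s)) * (1 + \<mu> s) * P $$ (s, l)"
      using s by (simp add: sum.distrib sum_distrib_right sum_lessThan_one)
    \<comment> \<open>Both corrections are \<open>(M $$ (i, s) - a $ i) / u $ s\<close> times
      \<open>P $$ (s, l)\<close> up to opposite signs, and cancel.\<close>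
    also have "\<dots> = (\<Sum>t<k. M $$ (i, t) * P $$ (t, l))"
      unfolding M\<mu> \<mu>s using us by (simp add: field_simps)
    also have "\<dots> = (M * P) $$ (i, l)" by (rule index_mult_mat_sum[OF M P il, symmetric])
    finally show "(?M * ?P) $$ (i, l) = (M * P) $$ (i, l)" .
  qed (use M M' P P' in auto)
  ultimately show ?thesis using M' P' sym unfolding is_pinv_def by auto
qed

section \<open>The procedure\<close>

lemma dim_sub_cols [simp]: "dim_row (sub_cols M B) = dim_row M" "dim_col (sub_cols M B) = length B"
  by (simp_all add: sub_cols_def)

lemma index_sub_cols [simp]:
  "i < dim_row M \<Longrightarrow> l < length B \<Longrightarrow> sub_cols M B $$ (i, l) = M $$ (i, B ! l)"
  by (simp add: sub_cols_def mat_of_cols_index col_def)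

lemma dim_sub_vec [simp]: "dim_vec (sub_vec x B) = length B"
  by (simp add: sub_vec_def)

lemma index_sub_vec [simp]: "l < length B \<Longrightarrow> sub_vec x B $ l = x $ (B ! l)"
  by (simp add: sub_vec_def)

lemma sub_cols_append: "sub_cols M (B @ [j]) = append_col (sub_cols M B) (col M j)"
  by (intro eq_matI) (auto simp: append_col_def nth_append col_def)

lemma sub_cols_list_update: "sub_cols M (B[s := j]) = replace_col (sub_cols M B) s (col M j)"
  by (intro eq_matI) (auto simp: replace_col_def nth_list_update col_def)

text \<open>Distinctness makes the sum over positions a sum over indices, and the indices outside
  \<open>B\<close> contribute zero. It serves \<open>A\<close> in the final representation and
  \<open>tilde A\<close> in comparing the points before and after the move.\<close>

lemma sub_cols_mult_sub_vec:
  fixes M :: "'a :: comm_semiring_0 mat"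
  assumes "x \<in> carrier_vec (dim_col M)" "distinct B" "set B \<subseteq> {..<dim_col M}"
    and supp: "\<And>i. i < dim_col M \<Longrightarrow> i \<notin> set B \<Longrightarrow> x $ i = 0"
  shows "sub_cols M B *\<^sub>v sub_vec x B = M *\<^sub>v x"
proof (intro eq_vecI)
  fix i assume "i < dim_vec (M *\<^sub>v x)"
  then have i: "i < dim_row M" by simp
  have "(sub_cols M B *\<^sub>v sub_vec x B) $ i = (\<Sum>l<length B. M $$ (i, B ! l) * x $ (B ! l))"
    using i by (auto simp: scalar_prod_def atLeast0LessThan intro!: sum.cong)
  also have "\<dots> = (\<Sum>c\<in>set B. M $$ (i, c) * x $ c)"
    using assms(2) by (intro sum.reindex_bij_betw bij_betw_nth) auto
  also have "\<dots> = (\<Sum>c<dim_col M. M $$ (i, c) * x $ c)"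
    using assms(3) supp by (intro sum.mono_neutral_left) auto
  also have "\<dots> = (M *\<^sub>v x) $ i"
    using i assms(1) by (auto simp: scalar_prod_def atLeast0LessThan intro!: sum.cong)
  finally show "(sub_cols M B *\<^sub>v sub_vec x B) $ i = (M *\<^sub>v x) $ i" .
qed auto

lemma scatter_carrier [simp]: "scatter e n B' z \<in> carrier_vec n"
  by (simp add: scatter_def)

lemma index_scatter_nth:
  assumes "distinct B'" "set B' \<subseteq> {..<n}" "l < length B'"
  shows "scatter e n B' z $ (B' ! l) = z $ l"
proof -
  have "B' ! l < n" using assms by (meson lessThan_iff nth_mem subsetD)
  then show ?thesis
    using map_of_zip_nth[of B' "[0..<length B']" l] assms by (simp add: scatter_def)
qed

lemma index_scatter_notin:
  assumes "i < n" "i \<notin> set B'"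
  shows "scatter e n B' z $ i = e"
proof -
  have "map_of (zip B' [0..<length B']) i = None"
    using assms(2) by (simp add: map_of_zip_is_None)
  then show ?thesis using assms(1) unfolding scatter_def by (subst index_vec) (simp_all only: option.case)
qed

lemma sub_vec_scatter:
  assumes "distinct B'" "set B' \<subseteq> {..<n}" "z \<in> carrier_vec (length B')"
  shows "sub_vec (scatter e n B' z) B' = z"
  using assms by (intro eq_vecI) (auto simp: index_scatter_nth)

section \<open>Lifting by a row of ones\<close>

lemma dim_top_row [simp]: "dim_row (top_row e A) = dim_row A + 1" "dim_col (top_row e A) = dim_col A"
  by (simp_all add: top_row_def)

lemma sub_cols_tilde:
  assumes "set B \<subseteq> {..<dim_col A}"
  shows "sub_cols (tilde A) B = tilde (sub_cols A B)"
proof (intro eq_matI)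
  fix i l assume "i < dim_row (tilde (sub_cols A B))" "l < dim_col (tilde (sub_cols A B))"
  moreover from this have "B ! l < dim_col A"
    using assms by (simp, meson lessThan_iff nth_mem subsetD)
  ultimately show "sub_cols (tilde A) B $$ (i, l) = tilde (sub_cols A B) $$ (i, l)"
    by (auto simp: top_row_def)
qed auto

lemma index_tilde_mult_0:
  assumes "v \<in> carrier_vec (dim_col A)"
  shows "(tilde A *\<^sub>v v) $ 0 = (\<Sum>i<dim_col A. v $ i)"
  using assms by (auto simp: scalar_prod_def top_row_def atLeast0LessThan intro!: sum.cong)

lemma index_tilde_mult_Suc:
  assumes "v \<in> carrier_vec (dim_col A)" "i < dim_row A"
  shows "(tilde A *\<^sub>v v) $ Suc i = (A *\<^sub>v v) $ i"
  using assms by (auto simp: scalar_prod_def top_row_def atLeast0LessThan intro!: sum.cong)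

text \<open>Entry 0 of the lifted product is the sum of the weights and the other entries are the
  original product, so one linear equation carries both.\<close>

lemma tilde_mult_eq_iff:
  assumes "v \<in> carrier_vec (dim_col A)" "w \<in> carrier_vec (dim_row A + 1)"
  shows "tilde A *\<^sub>v v = w \<longleftrightarrow>
    (\<Sum>i<dim_col A. v $ i) = w $ 0 \<and> A *\<^sub>v v = vec (dim_row A) (\<lambda>i. w $ Suc i)"
proof
  assume "tilde A *\<^sub>v v = w"
  then show "(\<Sum>i<dim_col A. v $ i) = w $ 0 \<and> A *\<^sub>v v = vec (dim_row A) (\<lambda>i. w $ Suc i)"
    using index_tilde_mult_0[OF assms(1)] index_tilde_mult_Suc[OF assms(1)] by (auto intro!: eq_vecI)
next
  assume R: "(\<Sum>i<dim_col A. v $ i) = w $ 0 \<and> A *\<^sub>v v = vec (dim_row A) (\<lambda>i. w $ Suc i)"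
  show "tilde A *\<^sub>v v = w"
  proof (intro eq_vecI)
    fix i assume "i < dim_vec w"
    then show "(tilde A *\<^sub>v v) $ i = w $ i"
      using R assms index_tilde_mult_0[OF assms(1)] index_tilde_mult_Suc[OF assms(1)]
      by (cases i) (auto simp del: index_mult_mat_vec)
  qed (use assms in auto)
qed

text \<open>With right-hand side zero, \<open>tilde_mult_eq_iff\<close> shows that the affine
  dependences of the columns form the kernel of the lifted matrix.\<close>

lemma aff_indep_cols_iff:
  "aff_indep_cols M \<longleftrightarrow>
    (\<forall>v \<in> carrier_vec (dim_col M). tilde M *\<^sub>v v = 0\<^sub>v (dim_row M + 1) \<longrightarrow> v = 0\<^sub>v (dim_col M))"
proof -
  have "vec (dim_row M) (\<lambda>i. 0\<^sub>v (dim_row M + 1) $ Suc i) = (0\<^sub>v (dim_row M) :: real vec)"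
    by (intro eq_vecI) auto
  then show ?thesis by (auto simp: aff_indep_cols_def tilde_mult_eq_iff)
qed

text \<open>Together with \<open>pinv_eqI\<close>, this lets the correctness proof carry
  \<open>is_pinv\<close> alone, which encodes affine independence as well as the
  pseudoinverse.\<close>

lemma aff_indep_cols_sub_cols_iff:
  assumes "set B \<subseteq> {..<dim_col A}"
  shows "aff_indep_cols (sub_cols A B) \<longleftrightarrow>
    is_pinv (sub_cols (tilde A) B) (pinv (sub_cols (tilde A) B))"
  unfolding aff_indep_cols_iff sub_cols_tilde[OF assms]
  using is_pinv_pinv[of "tilde (sub_cols A B)"] is_pinv_inj[of "tilde (sub_cols A B)"]
  by auto

section \<open>Formulas and costs of the two updates\<close>

text \<open>By symmetry of \<open>M P\<close>, the row vector \<open>a\<^sup>T M P\<close> is the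
  transpose of the projection \<open>M P a\<close>.\<close>

lemma scalar_prod_col_mult_sym:
  assumes M: "M \<in> carrier_mat r k" and pi: "is_pinv M P" and a: "a \<in> carrier_vec r" and c: "c < r"
  shows "a \<bullet> col (M * P) c = (M *\<^sub>v (P *\<^sub>v a)) $ c"
proof -
  have P: "P \<in> carrier_mat k r" and sym: "(M * P)\<^sup>T = M * P"
    using M pi by (auto simp: is_pinv_def)
  have "a \<bullet> col (M * P) c = row (M * P)\<^sup>T c \<bullet> a"
    using M P a c by (simp add: comm_scalar_prod[of _ r] del: sym)
  also have "\<dots> = (M * P *\<^sub>v a) $ c" using M P c by (simp add: sym)
  finally show ?thesis using assoc_mult_mat_vec[OF M P a] by simp
qed

text \<open>The row vector \<open>a\<^sup>T (I - M P)\<close> of the procedure is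
  \<open>q\<^sup>T\<close>, so that its matrix formula becomes the entrywise one of
  \<open>is_pinv_append_col\<close>.\<close>

lemma mIRR_independent_eq:
  assumes A: "A \<in> carrier_mat m n" and M: "M = sub_cols (tilde A) B" and pi: "is_pinv M P"
    and a: "a = col (tilde A) j" and q: "q = a - M *\<^sub>v (P *\<^sub>v a)"
    and u: "u = P *\<^sub>v a @\<^sub>v vec 1 (\<lambda>_. - 1)" and k: "k = length B"
  shows "mIRR_independent A B P j =
    mat (k + 1) (m + 1) (\<lambda>(i, c). (if i < k then P $$ (i, c) else 0) - u $ i * q $ c / (q \<bullet> a))"
proof -
  have Mc: "M \<in> carrier_mat (m + 1) k" and ac: "a \<in> carrier_vec (m + 1)"
    using A M a k by (auto intro!: carrier_vecI)
  have P: "P \<in> carrier_mat k (m + 1)" using Mc pi by (auto simp: is_pinv_def)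
  have row: "mat_of_row a * (1\<^sub>m (m + 1) - M * P) = mat_of_row q"
  proof (intro eq_matI)
    fix i c assume "i < dim_row (mat_of_row q)" "c < dim_col (mat_of_row q)"
    then have i: "i = 0" and c: "c < m + 1" using q ac Mc by auto
    have "(mat_of_row a * (1\<^sub>m (m + 1) - M * P)) $$ (i, c) =
        row (mat_of_row a) i \<bullet> col (1\<^sub>m (m + 1) - M * P) c"
      by (rule index_mult_mat(1)) (use i c Mc P in auto)
    also have "row (mat_of_row a) i = a" using i by simp
    also have "col (1\<^sub>m (m + 1) - M * P) c = unit_vec (m + 1) c - col (M * P) c"
      using c Mc P by (intro eq_vecI) auto
    also have "a \<bullet> (unit_vec (m + 1) c - col (M * P) c) = a \<bullet> unit_vec (m + 1) c - a \<bullet> col (M * P) c"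
      by (rule scalar_prod_minus_distrib[of _ "m + 1"]) (use ac Mc c in \<open>auto intro: carrier_vecI\<close>)
    also have "\<dots> = q $ c"
      using scalar_prod_col_mult_sym[OF Mc pi ac c] ac Mc c by (simp add: q)
    finally show "(mat_of_row a * (1\<^sub>m (m + 1) - M * P)) $$ (i, c) = mat_of_row q $$ (i, c)"
      using i c Mc by (simp add: q)
  qed (use q ac Mc P in auto)
  have qa: "(mat_of_row q *\<^sub>v a) $ 0 = q \<bullet> a" by simp
  have qd: "dim_vec q = m + 1" using q Mc by simp
  have uq: "(mat_of_cols (k + 1) [u] * mat_of_row q) $$ (i, c) = u $ i * q $ c" if "i < k + 1" "c < m + 1" for i c
    using that qd by (simp add: scalar_prod_def mat_of_cols_index)
  have "mIRR_independent A B P j =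
      (P @\<^sub>r 0\<^sub>m 1 (m + 1)) - (1 / (q \<bullet> a)) \<cdot>\<^sub>m (mat_of_cols (k + 1) [u] * mat_of_row q)"
    using A row qa by (simp add: mIRR_independent_def Let_def M[symmetric] a[symmetric] k[symmetric] u[symmetric]
        del: One_nat_def)
  also have "\<dots> = mat (k + 1) (m + 1) (\<lambda>(i, c). (if i < k then P $$ (i, c) else 0) - u $ i * q $ c / (q \<bullet> a))"
    using P qd uq by (intro eq_matI) (auto simp: append_rows_def simp del: index_mult_mat(1))
  finally show ?thesis .
qed

text \<open>Evaluating \<open>(a\<^sup>T M) P\<close> from the left takes only products of a vector
  and a matrix. The nonzero summands are the costs of \<open>h\<close>, \<open>g\<close>, the
  residual, its inner product with \<open>a\<close>, and three operations for each of the
  \<open>(k + 1) * r\<close> entries.\<close>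

lemma runs_mIRR_independent_prog:
  assumes M: "M \<in> carrier_mat r k" and pi: "is_pinv M P" and a: "a \<in> carrier_vec r"
    and q: "q = a - M *\<^sub>v (P *\<^sub>v a)" and neq: "M *\<^sub>v (P *\<^sub>v a) \<noteq> a"
  shows "runs (mIRR_independent_prog M P a u)
    (mat (k + 1) r (\<lambda>(i, c). (if i < k then P $$ (i, c) else 0) - u $ i * q $ c / (q \<bullet> a)))
    (0 + (k * (2 * r) + (r * (2 * k) + (r * 1 + (2 * r + (k + 1) * (r * (1 + (1 + 1))))))))"
proof -
  have P: "P \<in> carrier_mat k r" using M pi by (auto simp: is_pinv_def)
  define h where "h = vec k (\<lambda>c. a \<bullet> col M c)"
  define g where "g = vec r (\<lambda>c. h \<bullet> col P c)"
  have "h \<bullet> col P c = (M *\<^sub>v (P *\<^sub>v a)) $ c" if c: "c < r" for c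
  proof -
    have "col P c \<in> carrier_vec k" using P by (auto intro: carrier_vecI)
    then have "h \<bullet> col P c = a \<bullet> (M *\<^sub>v col P c)"
      using assoc_scalar_prod[OF a M, of "col P c"] M by (simp add: h_def mult_mat_vec_def)
    also have "M *\<^sub>v col P c = col (M * P) c" using M P c by (intro eq_vecI) auto
    finally show ?thesis using scalar_prod_col_mult_sym[OF M pi a c] by simp
  qed
  then have qg: "vec r (\<lambda>i. a $ i - g $ i) = q"
    using a M unfolding q g_def by (intro eq_vecI) auto
  have h: "runs (vec_mat_prog a M) h (k * (2 * r))"
    using runs_vec_mat_prog[of a M] M by (simp add: h_def)
  have g: "runs (vec_mat_prog h P) g (r * (2 * k))"
    using runs_vec_mat_prog[of h P] P by (simp add: g_def)
  have qr: "runs (vec_prog (dim_vec a) (\<lambda>i. sub (a $ i) (g $ i))) q (r * 1)"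
    unfolding qg[symmetric] carrier_vecD[OF a] by (intro runs_vec_prog runs_sub)
  have d: "runs (inner_prog q a) (q \<bullet> a) (2 * r)"
    using runs_inner_prog[of q a] a by simp
  have da: "dim_vec a = r" and dP: "dim_row P = k" using a P by auto
  show ?thesis
    unfolding mIRR_independent_prog_def da dP
    by (rule runs_bind[OF runs_const] runs_bind[OF h] runs_bind[OF g]
        runs_bind[OF qr[unfolded da]] runs_bind[OF d] runs_mat_prog runs_bind[OF runs_mul]
        runs_bind[OF runs_quot[OF residual_scalar_prod_neq_0[OF M pi a q neq]]]
        runs_sub[of "if _ then _ else 0"] | simp only: of_int_0)+
qed

lemma mIRR_pivot_eq:
  assumes "P \<in> carrier_mat k r" "s < k"
  shows "mIRR_pivot P u s =
    mat k r (\<lambda>(i, c). P $$ (i, c) + ((if i = s then 1 else 0) - u $ i) / u $ s * P $$ (s, c))"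
  using assms by (intro eq_matI) (auto simp: mIRR_pivot_def Let_def)

text \<open>Two operations per multiplier and two per entry; the nonzero pivot \<open>u $ s\<close>
  keeps the divisions defined.\<close>

lemma runs_mIRR_pivot_prog:
  assumes P: "P \<in> carrier_mat k r" and us: "u $ s \<noteq> 0" and s: "s < k"
  shows "runs (mIRR_pivot_prog P u s) (mIRR_pivot P u s)
    (0 + (0 + (k * (1 + 1) + k * (r * (1 + 1)))))"
proof -
  define \<mu> where "\<mu> i = ((if i = s then 1 else 0) - u $ i) / u $ s" for i
  have eq: "mIRR_pivot P u s = mat k r (\<lambda>(i, c). P $$ (i, c) + vec k \<mu> $ i * P $$ (s, c))"
    unfolding mIRR_pivot_eq[OF P s] by (intro eq_matI) (auto simp: \<mu>_def)
  have dP: "dim_row P = k" "dim_col P = r" using P by auto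
  have \<mu>: "runs (vec_prog k (\<lambda>i. sub (if i = s then of_int 1 else of_int 0) (u $ i) \<bind> (\<lambda>t. quot t (u $ s))))
      (vec k \<mu>) (k * (1 + 1))"
    unfolding \<mu>_def of_int_1 of_int_0
    by (intro runs_vec_prog) (rule runs_bind[OF runs_sub runs_quot[OF us]])
  show ?thesis
    unfolding mIRR_pivot_prog_def eq dP
    by (rule runs_bind[OF runs_const] runs_bind[OF \<mu>] runs_mat_prog
        runs_bind[OF runs_mul] runs_add)+
qed

text \<open>A negative entry rules out \<open>None\<close>, so the optimum exists. Position
  \<open>k\<close>, where \<open>u\<close> is -1, will supply such an entry.\<close>

lemma ratio_spec_obtain:
  assumes "ratio_spec (length B') (sub_vec x B') u b" "l < length B'" "u $ l < 0"
  obtains s where "b = Some (s, mIRR_theta B' u x)" "s = mIRR_leaving B' u x"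
    "s < length B'" "u $ s < 0" "mIRR_theta B' u x = x $ (B' ! s) / u $ s"
    "\<And>i. i < length B' \<Longrightarrow> u $ i < 0 \<Longrightarrow> x $ (B' ! i) / u $ i \<le> mIRR_theta B' u x"
proof -
  obtain s \<theta> where b: "b = Some (s, \<theta>)"
    using ratio_spec_None[OF assms] by force
  have "\<theta> = mIRR_theta B' u x" "s = mIRR_leaving B' u x"
    using mIRR_theta_eq[OF assms(1)[unfolded b]] mIRR_leaving_eq[OF assms(1)[unfolded b]] by simp_all
  with that[of s] assms(1) b show thesis by auto
qed

section \<open>Total operation count\<close>

text \<open>With \<open>r = m + 1\<close> and \<open>k \<le> r\<close>, the two matrix-vector
  products cost \<open>4 k r\<close>, the equality test \<open>r\<close>, and either branch at most
  \<open>14 r\<^sup>2\<close>; the sum is at most \<open>19 r\<^sup>2\<close>.\<close>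

lemma runs_mIRR_prog:
  assumes A: "A \<in> carrier_mat m n" and pi: "is_pinv (sub_cols (tilde A) B) P"
  shows "runs (mIRR_prog A B P j x) (mIRR A B P j x) (19 * (m + 1)\<^sup>2)"
proof -
  define k r where "k = length B" and "r = m + 1"
  define M a where "M = sub_cols (tilde A) B" and "a = col (tilde A) j"
  define u' where "u' = P *\<^sub>v a"
  define u where "u = u' @\<^sub>v vec 1 (\<lambda>_. - 1)"
  define B' where "B' = B @ [j]"
  define y where "y = sub_vec x B'"
  have M: "M \<in> carrier_mat r k" and a: "a \<in> carrier_vec r"
    using A by (auto simp: M_def a_def k_def r_def intro!: carrier_vecI)
  have pi: "is_pinv M P" using pi by (simp add: M_def)
  then have P: "P \<in> carrier_mat k r" and PM: "P * M = 1\<^sub>m k" using M by (auto simp: is_pinv_def)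
  have kr: "k \<le> r" by (rule left_inverse_dim_le[OF M P PM])
  then have krr: "k * r \<le> r * r" by (rule mult_le_mono1)
  have rr: "r \<le> r * r" by (simp add: r_def)
  have dim_u': "dim_vec u' = k" and u': "u' \<in> carrier_vec k" using P by (auto simp: u'_def intro: carrier_vecI)
  have dim_u: "dim_vec u = k + 1" by (simp add: u_def dim_u')
  have r1: "runs (mat_vec_prog P a) u' (k * (2 * r))"
    using runs_mat_vec_prog[of P a] P a by (simp add: u'_def)
  have r2: "runs (mat_vec_prog M u') (M *\<^sub>v u') (r * (2 * k))"
    using runs_mat_vec_prog[of M u'] M dim_u' by simp
  have r3: "runs (vec_eq_prog (M *\<^sub>v u') a) (M *\<^sub>v u' = a) r"
    using runs_vec_eq_prog[of "M *\<^sub>v u'" a] M a by simp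
  \<comment> \<open>The rest of the program after the equality test, with its inputs already
    evaluated.\<close>
  define body where "body = (if M *\<^sub>v u' \<noteq> a
     then do { Q \<leftarrow> mIRR_independent_prog M P a u; Return (x, B', Q) }
     else do {
       best \<leftarrow> ratio_upto (k + 1) y u;
       let s = fst (the best); \<theta> = snd (the best)
       in do {
         z \<leftarrow> vec_prog (k + 1) (\<lambda>i. do { t \<leftarrow> mul \<theta> (u $ i); sub (y $ i) t });
         let xp = scatter 0 n B' z
         in if s = k then Return (xp, B, P)
            else do { Q \<leftarrow> mIRR_pivot_prog P u' s; Return (xp, B[s := j], Q) }
       }
     })"
  have body: "runs body (mIRR A B P j x) (14 * r\<^sup>2)"
  proof (cases "M *\<^sub>v u' = a")
    case False
    let ?Q = "mIRR_independent A B P j"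
    have "runs (mIRR_independent_prog M P a u) ?Q
        (0 + (k * (2 * r) + (r * (2 * k) + (r * 1 + (2 * r + (k + 1) * (r * (1 + (1 + 1))))))))"
      using runs_mIRR_independent_prog[OF M pi a refl False[unfolded u'_def]]
      using mIRR_independent_eq[OF A M_def pi a_def refl u_def[unfolded u'_def] k_def]
      by (simp add: r_def)
    from runs_bind[OF this runs_Return]
    have "runs body (x, B', ?Q)
        (0 + (k * (2 * r) + (r * (2 * k) + (r * 1 + (2 * r + (k + 1) * (r * (1 + (1 + 1))))))) + 0)"
      by (simp only: body_def False not_False_eq_True if_True)
    also have "(x, B', ?Q) = mIRR A B P j x"
      using False by (simp add: mIRR_def Let_def B'_def M_def a_def u'_def)
    finally show ?thesis
    proof (rule runs_mono)
      \<comment> \<open>The total is \<open>7 k r + 6 r\<close>, at most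
        \<open>13 r\<^sup>2\<close>.\<close>
      show "0 + (k * (2 * r) + (r * (2 * k) + (r * 1 + (2 * r + (k + 1) * (r * (1 + (1 + 1))))))) + 0
          \<le> 14 * r\<^sup>2"
        using krr rr unfolding power2_eq_square by (simp only: algebra_simps)
    qed
  next
    case True
    have len: "length B' = k + 1" by (simp add: B'_def k_def)
    obtain b where ratio: "runs (ratio_upto (k + 1) y u) b (3 * (k + 1))"
      and spec: "ratio_spec (length B') (sub_vec x B') u b"
      using runs_ratio_upto[of "k + 1" y u] by (auto simp: y_def len)
    have "u $ k < 0" by (simp add: u_def dim_u')
    then obtain s
      where b: "b = Some (s, mIRR_theta B' u x)" and s: "s = mIRR_leaving B' u x"
        and sk: "s < k + 1" and us: "u $ s < 0"
      using ratio_spec_obtain[OF spec, of k] unfolding len by (metis less_add_one)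
    define \<theta> where "\<theta> = mIRR_theta B' u x"
    have b': "b = Some (s, \<theta>)" by (simp add: b \<theta>_def)
    define z where "z = y - \<theta> \<cdot>\<^sub>v u"
    have "vec (k + 1) (\<lambda>i. y $ i - \<theta> * u $ i) = z"
      by (intro eq_vecI) (auto simp: z_def dim_u y_def len)
    then have z: "runs (vec_prog (k + 1) (\<lambda>i. do { t \<leftarrow> mul \<theta> (u $ i); sub (y $ i) t })) z ((k + 1) * (1 + 1))"
      by (metis (no_types, lifting) runs_vec_prog runs_bind runs_mul runs_sub)
    have mIRR: "mIRR A B P j x =
       (if s = k then (scatter 0 n B' z, B, P)
        else (scatter 0 n B' z, B[s := j], mIRR_pivot P u' s))"
      using True A
      by (simp add: mIRR_def Let_def M_def[symmetric] a_def[symmetric] u'_def[symmetric] u_def[symmetric]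
          B'_def[symmetric] k_def[symmetric] \<theta>_def[symmetric] s[symmetric] z_def y_def
          del: One_nat_def)
    let ?end = "if s = k then Return (scatter 0 n B' z, B, P)
      else do { Q \<leftarrow> mIRR_pivot_prog P u' s; Return (scatter 0 n B' z, B[s := j], Q) }"
    let ?T = "0 + (0 + (k * (1 + 1) + k * (r * (1 + 1)))) + 0"
    have fin: "runs ?end (mIRR A B P j x) ?T"
    proof (cases "s = k")
      case True
      then show ?thesis using runs_mono[OF runs_Return, of ?T] by (simp add: mIRR)
    next
      case False
      then have "u' $ s \<noteq> 0" "s < k" using us sk by (auto simp: u_def dim_u')
      from runs_bind[OF runs_mIRR_pivot_prog[OF P this] runs_Return] False
      show ?thesis by (simp only: mIRR if_False)
    qed
    have "runs body (mIRR A B P j x) (3 * (k + 1) + ((k + 1) * (1 + 1) + ?T))"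
      unfolding body_def Let_def if_not_P[OF not_not[THEN iffD2, OF True]]
      apply (rule runs_bind[OF ratio])
      apply (simp only: b' option.sel fst_conv snd_conv)
      apply (rule runs_bind[OF z])
      apply (rule fin)
      done
    then show ?thesis
    proof (rule runs_mono)
      have "1 \<le> r" by (simp add: r_def)
      have "3 * (k + 1) + ((k + 1) * (1 + 1) + ?T) = 5 + 7 * k + 2 * (k * r)"
        by (simp add: algebra_simps)
      \<comment> \<open>Here \<open>14 = 5 + 7 + 2\<close>, as \<open>1\<close>, \<open>k\<close>
        and \<open>k r\<close> are all bounded by \<open>r\<^sup>2\<close>.\<close>
      also have "\<dots> \<le> 14 * (r * r)" using kr krr rr \<open>1 \<le> r\<close> by linarith
      finally show "3 * (k + 1) + ((k + 1) * (1 + 1) + ?T) \<le> 14 * r\<^sup>2"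
        by (simp add: power2_eq_square)
    qed
  qed
  have "runs (mIRR_prog A B P j x) (mIRR A B P j x)
      (0 + (0 + (0 + (k * (2 * r) + (r * (2 * k) + (r + 14 * r\<^sup>2))))))"
    unfolding mIRR_prog_def Let_def
    apply (rule runs_bind[OF runs_const])+
    apply (unfold of_int_0 of_int_1 of_int_minus)
    apply (fold M_def a_def k_def B'_def)
    apply (rule runs_bind[OF r1])
    apply (rule runs_bind[OF r2])
    apply (rule runs_bind[OF r3])
    apply (unfold carrier_matD(2)[OF A])
    apply (fold y_def u_def)
    apply (rule body[unfolded body_def Let_def])
    done
  then show ?thesis
  proof (rule runs_mono)
    show "0 + (0 + (0 + (k * (2 * r) + (r * (2 * k) + (r + 14 * r\<^sup>2))))) \<le> 19 * (m + 1)\<^sup>2"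
      unfolding r_def[symmetric] power2_eq_square using krr rr by (simp only: algebra_simps)
  qed
qed

section \<open>Correctness of the output\<close>

lemma mIRR_correct:
  assumes A: "A \<in> carrier_mat m n" and B: "distinct B" "set B \<subseteq> {..<n}"
    and pi: "is_pinv (sub_cols (tilde A) B) P"
    and j: "j < n" "j \<notin> set B"
    and x: "x \<in> std_simplex n" "\<And>i. i < n \<Longrightarrow> i \<notin> set B \<union> {j} \<Longrightarrow> x $ i = 0"
    and res: "mIRR A B P j x = (xp, Bp, Pp)"
  shows "distinct Bp" "set Bp \<subseteq> {..<n}" "is_pinv (sub_cols (tilde A) Bp) Pp"
    "xp \<in> std_simplex n" "\<And>i. i < n \<Longrightarrow> i \<notin> set Bp \<Longrightarrow> xp $ i = 0" "A *\<^sub>v xp = A *\<^sub>v x"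
proof -
  define k r where "k = length B" and "r = m + 1"
  define M a where "M = sub_cols (tilde A) B" and "a = col (tilde A) j"
  define u' where "u' = P *\<^sub>v a"
  define u where "u = u' @\<^sub>v vec 1 (\<lambda>_. - 1)"
  define B' where "B' = B @ [j]"
  define \<theta> s where "\<theta> = mIRR_theta B' u x" and "s = mIRR_leaving B' u x"
  define z where "z = sub_vec x B' - \<theta> \<cdot>\<^sub>v u"
  have M: "M \<in> carrier_mat r k" and a: "a \<in> carrier_vec r"
    using A by (auto simp: M_def a_def k_def r_def intro!: carrier_vecI)
  have pi: "is_pinv M P" using pi by (simp add: M_def)
  then have P: "P \<in> carrier_mat k r" using M by (auto simp: is_pinv_def)
  have dim_u': "dim_vec u' = k" and u': "u' \<in> carrier_vec k" using P by (auto simp: u'_def intro: carrier_vecI)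
  have u: "u \<in> carrier_vec (k + 1)" and dim_u: "dim_vec u = k + 1"
    by (auto simp: u_def dim_u' intro: carrier_vecI)
  have B': "distinct B'" "set B' \<subseteq> {..<n}" "set B' = set B \<union> {j}" and len: "length B' = k + 1"
    using B j by (auto simp: B'_def k_def)
  have xc: "x \<in> carrier_vec n" and x0: "\<And>i. i < n \<Longrightarrow> 0 \<le> x $ i" and x1: "(\<Sum>i<n. x $ i) = 1"
    using x(1) by (auto simp: std_simplex_def)
  have mIRR: "mIRR A B P j x =
     (if M *\<^sub>v u' \<noteq> a then (x, B', mIRR_independent A B P j)
      else if s = k then (scatter 0 n B' z, B, P)
      else (scatter 0 n B' z, B[s := j], mIRR_pivot P u' s))"
    using A
    by (simp add: mIRR_def Let_def M_def[symmetric] a_def[symmetric] u'_def[symmetric] u_def[symmetric]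
        B'_def[symmetric] k_def[symmetric] \<theta>_def[symmetric] s_def[symmetric] z_def
        del: One_nat_def)
  have "distinct Bp \<and> set Bp \<subseteq> {..<n} \<and> is_pinv (sub_cols (tilde A) Bp) Pp \<and>
    xp \<in> std_simplex n \<and> (\<forall>i<n. i \<notin> set Bp \<longrightarrow> xp $ i = 0) \<and> A *\<^sub>v xp = A *\<^sub>v x"
  proof (cases "M *\<^sub>v u' = a")
    case False
    then have out: "xp = x" "Bp = B'" "Pp = mIRR_independent A B P j"
      using res by (simp_all add: mIRR)
    have "sub_cols (tilde A) B' = append_col M a"
      by (simp add: B'_def sub_cols_append M_def a_def)
    then have "is_pinv (sub_cols (tilde A) Bp) Pp"
      using is_pinv_append_col[OF M pi a False[unfolded u'_def] refl u_def[unfolded u'_def]]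
        mIRR_independent_eq[OF A M_def pi a_def refl u_def[unfolded u'_def] k_def]
      by (simp add: out r_def)
    then show ?thesis using B' x by (simp add: out)
  next
    case True
    obtain b where spec: "ratio_spec (length B') (sub_vec x B') u b"
      using runs_ratio_upto by blast
    have uk: "u $ k < 0" by (simp add: u_def dim_u')
    obtain sk: "s < k + 1" and us: "u $ s < 0" and \<theta>: "\<theta> = x $ (B' ! s) / u $ s"
      and max: "\<And>i. i < k + 1 \<Longrightarrow> u $ i < 0 \<Longrightarrow> x $ (B' ! i) / u $ i \<le> \<theta>"
      using ratio_spec_obtain[OF spec, of k] uk unfolding len \<theta>_def s_def by (metis less_add_one)
    have B'n: "B' ! i < n" if "i < k + 1" for i
      using that B'(2) len by (metis lessThan_iff nth_mem subsetD)
    \<comment> \<open>A nonnegative entry divided by a negative one; this sign protects the entries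
      at which \<open>u\<close> is nonnegative.\<close>
    have \<theta>0: "\<theta> \<le> 0" unfolding \<theta> using us x0[OF B'n[OF sk]] by (simp add: divide_nonneg_neg)
    have z: "z $ i = x $ (B' ! i) - \<theta> * u $ i" if "i < k + 1" for i
      using that by (simp add: z_def dim_u len)
    have zc: "z \<in> carrier_vec (k + 1)" by (auto simp: z_def dim_u intro: carrier_vecI)
    \<comment> \<open>Where \<open>u $ i < 0\<close>, this is the maximality of
      \<open>\<theta>\<close> multiplied by \<open>u $ i\<close>; elsewhere
      \<open>\<theta> * u $ i\<close> is at most 0.\<close>
    have z0: "0 \<le> z $ i" if i: "i < k + 1" for i
    proof (cases "u $ i < 0")
      case True
      then show ?thesis using max[OF i True] by (simp add: z[OF i] neg_divide_le_eq mult.commute)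
    next
      case False
      then show ?thesis using \<theta>0 x0[OF B'n[OF i]] mult_nonpos_nonneg[of \<theta> "u $ i"]
        by (simp add: z[OF i])
    qed
    \<comment> \<open>The leaving entry reaches 0, so its index may be dropped from
      \<open>B'\<close>.\<close>
    have zs: "z $ s = 0" using us by (simp add: z[OF sk] \<theta>)
    define w where "w = scatter 0 n B' z"
    have wc: "w \<in> carrier_vec n" by (simp add: w_def)
    have w: "w $ (B' ! i) = z $ i" if "i < k + 1" for i
      using that B' len by (simp add: w_def index_scatter_nth)
    have w0: "w $ i = 0" if "i < n" "i \<notin> set B'" for i
      using that by (simp add: w_def index_scatter_notin)
    \<comment> \<open>\<open>u\<close> encodes the dependence \<open>M u' - a = 0\<close> of the
      lifted columns, hence a direction that keeps both \<open>A x\<close> and the sum of the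
      weights.\<close>
    have Mu: "sub_cols (tilde A) B' *\<^sub>v u = 0\<^sub>v r"
    proof (intro eq_vecI)
      fix i assume "i < dim_vec (0\<^sub>v r :: real vec)"
      then have i: "i < r" by simp
      have "(sub_cols (tilde A) B' *\<^sub>v u) $ i = (\<Sum>l<k + 1. append_col M a $$ (i, l) * u $ l)"
        unfolding B'_def sub_cols_append M_def[symmetric] a_def[symmetric]
        by (rule index_mult_mat_vec_sum[OF _ u i]) (use M in \<open>auto simp: append_col_def\<close>)
      also have "\<dots> = (\<Sum>l<k. M $$ (i, l) * u' $ l) - a $ i"
        using M i by (simp add: append_col_def u_def dim_u' cong: sum.cong_simp)
      also have "(\<Sum>l<k. M $$ (i, l) * u' $ l) = a $ i"
        using index_mult_mat_vec_sum[OF M u' i] True by simp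
      finally show "(sub_cols (tilde A) B' *\<^sub>v u) $ i = 0\<^sub>v r $ i" using i by simp
    qed (use A r_def in auto)
    have "tilde A *\<^sub>v w = sub_cols (tilde A) B' *\<^sub>v sub_vec w B'"
      by (rule sub_cols_mult_sub_vec[symmetric]) (use A wc B' w0 in auto)
    also have "sub_vec w B' = z" unfolding w_def using B' zc len by (simp add: sub_vec_scatter)
    also have "sub_cols (tilde A) B' *\<^sub>v z =
        sub_cols (tilde A) B' *\<^sub>v sub_vec x B' - \<theta> \<cdot>\<^sub>v (sub_cols (tilde A) B' *\<^sub>v u)"
      unfolding z_def using A u len
      by (subst mult_minus_distrib_mat_vec[of _ r "k + 1"])
        (auto simp: r_def mult_mat_vec[of _ "Suc m" "Suc k"] intro!: carrier_matI carrier_vecI)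
    also have "\<dots> = sub_cols (tilde A) B' *\<^sub>v sub_vec x B'"
      unfolding Mu using A by (intro eq_vecI) (auto simp: r_def)
    also have "\<dots> = tilde A *\<^sub>v x"
      by (rule sub_cols_mult_sub_vec) (use A xc B' x(2) in auto)
    finally have tw: "tilde A *\<^sub>v w = tilde A *\<^sub>v x" .
    have "tilde A *\<^sub>v x \<in> carrier_vec (dim_row A + 1)" by (auto intro: carrier_vecI)
    from tilde_mult_eq_iff[OF _ this] have
      sum_w: "(\<Sum>i<n. w $ i) = (\<Sum>i<n. x $ i)" and Aw: "A *\<^sub>v w = A *\<^sub>v x"
      using A wc xc tw by (metis carrier_matD(2))+
    have wnn: "0 \<le> w $ i" if "i < n" for i
    proof (cases "i \<in> set B'")
      case True
      then obtain l where "l < k + 1" "i = B' ! l" using len by (metis in_set_conv_nth)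
      then show ?thesis using w z0 by simp
    next
      case False
      then show ?thesis using w0 that by simp
    qed
    have ws: "w \<in> std_simplex n" using wnn wc sum_w x1 by (simp add: std_simplex_def)
    show ?thesis
    proof (cases "s = k")
      case True
      then have out: "xp = w" "Bp = B" "Pp = P"
        using res \<open>M *\<^sub>v u' = a\<close> by (simp_all add: mIRR w_def)
      \<comment> \<open>Position \<open>k\<close> of \<open>B'\<close> holds \<open>j\<close>, so
        the vanishing entry is the one at \<open>j\<close> and \<open>w\<close> is supported on
        \<open>B\<close>.\<close>
      have "w $ j = 0" using w[of k] zs True by (simp add: B'_def k_def)
      then have "w $ i = 0" if "i < n" "i \<notin> set B" for i
        using that w0[of i] B'(3) by (cases "i = j") auto
      then show ?thesis using B pi ws Aw by (simp add: out M_def)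
    next
      case False
      then have s: "s < k" using sk by simp
      have out: "xp = w" "Bp = B[s := j]" "Pp = mIRR_pivot P u' s"
        using res \<open>M *\<^sub>v u' = a\<close> False by (simp_all add: mIRR w_def)
      have us': "u' $ s \<noteq> 0" using us s by (simp add: u_def dim_u')
      \<comment> \<open>Distinctness of \<open>B\<close> ensures that the update removes
        \<open>B ! s\<close> altogether.\<close>
      have setBp: "set Bp = insert j (set B - {B ! s})"
        using B(1) s by (simp add: out set_update_distinct k_def)
      have "is_pinv (sub_cols (tilde A) Bp) Pp"
        unfolding out sub_cols_list_update M_def[symmetric] a_def[symmetric] mIRR_pivot_eq[OF P s]
        by (rule is_pinv_replace_col[OF M pi a u' True s us']) simp
      moreover have "w $ i = 0" if "i < n" "i \<notin> set Bp" for i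
      proof (cases "i = B ! s")
        case True
        then show ?thesis using w[of s] zs s by (simp add: B'_def k_def nth_append)
      next
        case False
        then show ?thesis using that w0[of i] B'(3) setBp by auto
      qed
      moreover have "distinct Bp" using B(1) j by (simp add: out distinct_list_update)
      ultimately show ?thesis using B j ws Aw setBp by (auto simp: out)
    qed
  qed
  then show "distinct Bp" "set Bp \<subseteq> {..<n}" "is_pinv (sub_cols (tilde A) Bp) Pp"
    "xp \<in> std_simplex n" "\<And>i. i < n \<Longrightarrow> i \<notin> set Bp \<Longrightarrow> xp $ i = 0" "A *\<^sub>v xp = A *\<^sub>v x"
    by auto
qed

theorem corollary1:
  shows "\<exists>C :: nat.
    \<forall>(m :: nat) (n :: nat) (A :: real mat) (B :: nat list) (P :: real mat) (j :: nat)
      (x :: real vec) (y :: real vec).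
      m \<ge> 1 \<and> A \<in> carrier_mat m n \<and>
      distinct B \<and> set B \<subseteq> {..<n} \<and> aff_indep_cols (sub_cols A B) \<and>
      P = pinv (sub_cols (tilde A) B) \<and>
      j < n \<and> j \<notin> set B \<and>
      x \<in> std_simplex n \<and> (\<forall>i<n. i \<notin> set B \<union> {j} \<longrightarrow> x $ i = 0) \<and>
      y = A *\<^sub>v x \<and> y = sub_cols A B *\<^sub>v sub_vec x B + x $ j \<cdot>\<^sub>v col A j
      \<longrightarrow>
      (\<exists>xp Bp Pp t.
        mIRR A B P j x = (xp, Bp, Pp) \<and>
        exec (mIRR_prog A B P j x) = Some ((xp, Bp, Pp), t) \<and> t \<le> C * m ^ 2 \<and>
        distinct Bp \<and> set Bp \<subseteq> {..<n} \<and> aff_indep_cols (sub_cols A Bp) \<and>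
        xp \<in> std_simplex n \<and> (\<forall>i<n. i \<notin> set Bp \<longrightarrow> xp $ i = 0) \<and>
        y = A *\<^sub>v xp \<and> y = sub_cols A Bp *\<^sub>v sub_vec xp Bp \<and>
        Pp = pinv (sub_cols (tilde A) Bp))"
proof (intro exI[of _ 76] allI impI, elim conjE)
  fix m n :: nat and A :: "real mat" and B :: "nat list" and P :: "real mat" and j :: nat
    and x y :: "real vec"
  assume m: "1 \<le> m" and A: "A \<in> carrier_mat m n" and B: "distinct B" "set B \<subseteq> {..<n}"
    and indep: "aff_indep_cols (sub_cols A B)" and P: "P = pinv (sub_cols (tilde A) B)"
    and j: "j < n" "j \<notin> set B" and x: "x \<in> std_simplex n"
    and supp: "\<forall>i<n. i \<notin> set B \<union> {j} \<longrightarrow> x $ i = 0" and y: "y = A *\<^sub>v x"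
  \<comment> \<open>From here on the two equations for \<open>P\<close> stand for affine
    independence.\<close>
  have pi: "is_pinv (sub_cols (tilde A) B) P"
    using indep B(2) A aff_indep_cols_sub_cols_iff[of B A] by (simp add: P)
  obtain xp Bp Pp where res: "mIRR A B P j x = (xp, Bp, Pp)" by (metis prod_cases3)
  from runs_mIRR_prog[OF A pi, of j x] obtain t
    where t: "exec (mIRR_prog A B P j x) = Some ((xp, Bp, Pp), t)" "t \<le> 19 * (m + 1)\<^sup>2"
    by (auto simp: runs_def res)
  \<comment> \<open>From \<open>m \<ge> 1\<close> follows \<open>m + 1 \<le> 2 * m\<close>, which
    turns 19 into the constant \<open>76 = 4 * 19\<close>.\<close>
  have "(m + 1)\<^sup>2 \<le> (2 * m)\<^sup>2" using m by (intro power_mono) auto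
  with t(2) have tm: "t \<le> 76 * m\<^sup>2" by (simp add: power_mult_distrib)
  note c = mIRR_correct[OF A B pi j x _ res]
  have c: "distinct Bp" "set Bp \<subseteq> {..<n}" "is_pinv (sub_cols (tilde A) Bp) Pp"
    "xp \<in> std_simplex n" "\<forall>i<n. i \<notin> set Bp \<longrightarrow> xp $ i = 0" "A *\<^sub>v xp = A *\<^sub>v x"
    using c supp by blast+
  \<comment> \<open>The two equations identify the computed matrix with the pseudoinverse, and
    affine independence of the new columns is then read off from them.\<close>
  have Pp: "Pp = pinv (sub_cols (tilde A) Bp)" using pinv_eqI[OF c(3)] by simp
  have "aff_indep_cols (sub_cols A Bp)"
    using c(2,3) A aff_indep_cols_sub_cols_iff[of Bp A] by (simp add: Pp)
  moreover have "sub_cols A Bp *\<^sub>v sub_vec xp Bp = A *\<^sub>v xp"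
    using c(1,2,4,5) A by (intro sub_cols_mult_sub_vec) (auto simp: std_simplex_def)
  ultimately show "\<exists>xp Bp Pp t.
        mIRR A B P j x = (xp, Bp, Pp) \<and>
        exec (mIRR_prog A B P j x) = Some ((xp, Bp, Pp), t) \<and> t \<le> 76 * m ^ 2 \<and>
        distinct Bp \<and> set Bp \<subseteq> {..<n} \<and> aff_indep_cols (sub_cols A Bp) \<and>
        xp \<in> std_simplex n \<and> (\<forall>i<n. i \<notin> set Bp \<longrightarrow> xp $ i = 0) \<and>
        y = A *\<^sub>v xp \<and> y = sub_cols A Bp *\<^sub>v sub_vec xp Bp \<and>
        Pp = pinv (sub_cols (tilde A) Bp)"
    using res t(1) tm c Pp y by auto
qed

end
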